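(* For every prime power $q\ge 4$ there exists a set $\mathcal X$ of $q^2-q+1$ points of $\mathrm{AG}(6,q)$ that is both a $5$-general set and a $(6,4)$-set, and that is transitive: the group of projectivities of $\mathrm{PG}(6,q)$ stabilizing $\mathcal X$ and the hyperplane at infinity acts transitively on the points of $\mathcal X$.
   Context: For integers $r,s$, an $(r,s)$-set of $\mathrm{PG}(n,q)$ is a set $\mathcal X$ of points such that: (i) every $s$-dimensional projective subspace contains at most $r$ points of $\mathcal X$; (ii) $\mathcal X$ spans $\mathrm{PG}(n,q)$; (iii) some $(s+1)$-dimensional projective subspace contains $r+2$ points of $\mathcal X$. A $k$-general set is a $(k-1,k-2)$-set (so a $5$-general set is a $(4,3)$-set). A set of points of $\mathrm{AG}(n,q)$ is called an $(r,s)$-set (resp. $k$-general set) of $\mathrm{AG}(n,q)$ if, regarded as a subset of $\mathrm{PG}(n,q)=\mathrm{AG}(n,q)\cup H_\infty$ ($H_\infty$ the hyperplane at infinity), it is an $(r,s)$-set (resp. $k$-general set) of $\mathrm{PG}(n,q)$. *)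

theory Defs
  imports "HOL-Analysis.Analysis"
begin

text \<open>Projective space PG(n,F) modelled on the vector space F^('n), CARD('n) = n+1.
  A projective point is the set of nonzero scalar multiples of a nonzero vector.\<close>

definition proj_point :: "('a::field ^ 'n) \<Rightarrow> ('a ^ 'n) set" where
  "proj_point v = {c *s v | c. c \<noteq> 0}"

definition is_proj_point :: "('a::field ^ 'n) set \<Rightarrow> bool" where
  "is_proj_point P \<longleftrightarrow> (\<exists>v. v \<noteq> 0 \<and> P = proj_point v)"

text \<open>A projective subspace of projective dimension d is a linear subspace of vector
  dimension d+1; a point lies in it iff its vectors do.\<close>

definition proj_subspace :: "nat \<Rightarrow> ('a::field ^ 'n) set \<Rightarrow> bool" where
  "proj_subspace d W \<longleftrightarrow> vec.subspace W \<and> vec.dim W = d + 1"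

definition pts_in :: "('a::field ^ 'n) set set \<Rightarrow> ('a ^ 'n) set \<Rightarrow> nat" where
  "pts_in X W = card {P \<in> X. P \<subseteq> W}"

definition rs_set :: "nat \<Rightarrow> nat \<Rightarrow> ('a::field ^ 'n) set set \<Rightarrow> bool" where
  "rs_set r s X \<longleftrightarrow>
     (\<forall>P\<in>X. is_proj_point P) \<and>
     (\<forall>W. proj_subspace s W \<longrightarrow> pts_in X W \<le> r) \<and>
     vec.span (\<Union>X) = UNIV \<and>
     (\<exists>W. proj_subspace (s + 1) W \<and> pts_in X W \<ge> r + 2)"

definition k_general :: "nat \<Rightarrow> ('a::field ^ 'n) set set \<Rightarrow> bool" where
  "k_general k X \<longleftrightarrow> rs_set (k - 1) (k - 2) X"

definition H_inf :: "('a::field ^ 'n::{finite,zero}) set" where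
  "H_inf = {x. x $ 0 = 0}"

definition affine_point_set :: "('a::field ^ 'n::{finite,zero}) set set \<Rightarrow> bool" where
  "affine_point_set X \<longleftrightarrow> (\<forall>P\<in>X. \<not> P \<subseteq> H_inf)"

definition proj_map :: "('a::field ^ 'n ^ 'n) \<Rightarrow> ('a ^ 'n) set \<Rightarrow> ('a ^ 'n) set" where
  "proj_map A P = (\<lambda>v. A *v v) ` P"

end

theory Submission
  imports Defs "HOL-Algebra.Algebraic_Closure_Type"
begin

text \<open>
  Let \<open>K\<close> be an algebraic closure of \<open>\<F>\<^sub>q\<close> and \<open>\<mu>\<close> the group of roots of unity of exponent
  \<open>q\<^sup>2 - q + 1\<close> in the subfield with \<open>q\<^sup>6\<close> elements. The points are the vectors \<open>(1, x)\<close> with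
  \<open>x\<close> in \<open>\<mu>\<close>, written in trace coordinates, so a hyperplane is the zero set of
  \<open>c\<^sub>0 + Tr (c x)\<close>. With \<open>y = x\<^sup>q\<close> the six conjugates of \<open>x\<close> are
  \<open>x, y, y/x, 1/x, 1/y, x/y\<close>.

  Any five points are independent: for \<open>a, b, c, d\<close> in \<open>\<mu>\<close> the product of the \<open>\<F>\<^sub>q\<close>-line form
  through \<open>a, b\<close> in \<open>x\<close> and the one through \<open>1/c, 1/d\<close> in \<open>1/x\<close> is a combination of \<open>1\<close> and these
  conjugates, and it has only the zeros \<open>a, b, c, d\<close> in \<open>\<mu>\<close>. Two independent functionals are,
  after multiplication by \<open>x y\<close>, quadratic polynomials in \<open>x\<close> over \<open>K[y]\<close> whose resultant is \<open>y\<close>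
  times a nonzero polynomial of degree at most 6, so they share at most six zeros. Six
  dependent points come from counting the combinations of two differences \<open>x - 1/x\<close>, which lie in
  a space of only \<open>q\<^sup>3\<close> elements. Multiplication by \<open>\<mu>\<close> provides the transitive group.
\<close>


hide_const (open) Polynomials.degree up_ring.monom up_ring.coeff module.smult
no_notation var (\<open>X\<index>\<close>)

section \<open>Finite fields and the Frobenius map on the algebraic closure\<close>

lemma power_card_finite_field:
  fixes a :: "'a::{finite,field}"
  shows "a ^ CARD('a) = a"
proof (cases "a = 0")
  case False
  have "(\<Prod>x\<in>UNIV-{0::'a}. a * x) = \<Prod>(UNIV-{0::'a})"
    by (rule prod.reindex_bij_witness[of _ "\<lambda>x. x / a" "\<lambda>x. a * x"]) (use False in auto)
  then have "a ^ card (UNIV-{0::'a}) * \<Prod>(UNIV-{0::'a}) = 1 * \<Prod>(UNIV-{0::'a})"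
    by (simp add: prod.distrib)
  then have "a ^ card (UNIV-{0::'a}) = 1"
    unfolding mult_cancel_right by simp
  moreover have "CARD('a) = Suc (card (UNIV-{0::'a}))"
    by (metis card.remove finite UNIV_I)
  ultimately show ?thesis by (metis power_Suc mult.right_neutral)
qed (simp add: zero_power)

text \<open>Translation by 1 permutes the field. Consequently q^2 - q + 1 equals 1 in
  \<open>K\<close>, which makes the roots of unity of that exponent distinct.\<close>

lemma of_nat_card_finite_field: "of_nat CARD('a) = (0::'a::{finite,field})"
proof -
  have "(\<Sum>x\<in>(UNIV::'a set). x + 1) = \<Sum>UNIV"
    by (rule sum.reindex_bij_witness[of _ "\<lambda>x. x - 1" "\<lambda>x. x + 1"]) auto
  then show ?thesis by (simp add: sum.distrib)
qed

text \<open>Both polynomials are monic of degree \<open>n\<close>, so the leading terms cancel. For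
  n = q the difference is too small to vanish on all of F_q without being zero.\<close>

lemma degree_power_sum_less:
  fixes y :: "'b::field"
  assumes "n > 0"
  shows "degree ([:y, 1:] ^ n - monom 1 n) < n"
proof -
  have "degree ([:y, 1:] ^ n - monom 1 n) \<le> n"
    by (intro degree_diff_le) (auto simp: degree_power_eq degree_monom_le)
  moreover have "coeff ([:y, 1:] ^ n) n = 1"
    using lead_coeff_power[of "[:y,1:]" n] by (simp add: degree_power_eq)
  then have "coeff ([:y, 1:] ^ n - monom 1 n) n = 0" by simp
  ultimately show ?thesis
    using assms by (metis degree_0 leading_coeff_0_iff le_neq_implies_less)
qed

definition frob :: "'a::{finite,field} alg_closure \<Rightarrow> 'a alg_closure" where
  "frob x = x ^ CARD('a)"

lemma frob_to_ac [simp]: "frob (to_ac a) = to_ac a"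
  by (simp add: frob_def flip: to_ac_power) (simp add: power_card_finite_field)

lemma card_range_to_ac: "card (range (to_ac :: 'a::{finite,field} \<Rightarrow> _)) = CARD('a)"
  by (simp add: card_image inj_to_ac)

text \<open>As a polynomial in \<open>x\<close>, the defect \<open>(x + y)\<^sup>q - x\<^sup>q - y\<^sup>q\<close> has degree less
  than \<open>q\<close>; it vanishes on \<open>\<F>\<^sub>q\<close>, at first for \<open>y\<close> in \<open>\<F>\<^sub>q\<close> and then for all \<open>y\<close>.\<close>
lemma frob_add [simp]: "frob (x + y) = frob x + frob (y :: 'a::{finite,field} alg_closure)"
proof -
  have *: "frob (x + y) = frob x + frob y" if "\<And>a. frob (to_ac a + y) = to_ac a + frob y"
    for x y :: "'a alg_closure"
  proof -
    define P where "P = [:y, 1:] ^ CARD('a) - monom 1 CARD('a) - [:frob y:]"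
    have P: "poly P z = frob (z + y) - frob z - frob y" for z
      by (simp add: P_def frob_def poly_monom add.commute)
    have "degree P < CARD('a)"
      unfolding P_def
      by (rule degree_diff_less[OF degree_power_sum_less]) auto
    then have "P = 0"
      using that by (intro poly_eqI_degree[of "range to_ac"]) (auto simp: P card_range_to_ac)
    then show ?thesis using P[of x] by (simp add: algebra_simps)
  qed
  have "frob (x + to_ac b) = frob x + to_ac b" for x :: "'a alg_closure" and b
    using *[of "to_ac b" x] by (simp flip: to_ac_add)
  then show ?thesis by (intro *) (simp add: add.commute)
qed

lemma frob_mult [simp]: "frob (x * y) = frob x * frob y"
  and frob_power [simp]: "frob (x ^ n) = frob x ^ n"
  and frob_inverse [simp]: "frob (inverse x) = inverse (frob x)"
  and frob_divide [simp]: "frob (x / y) = frob x / frob y"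
  and frob_eq_0_iff [simp]: "frob x = 0 \<longleftrightarrow> x = 0"
proof -
  show "frob (x ^ n) = frob x ^ n" unfolding frob_def by (metis power_mult mult.commute)
qed (simp_all add: frob_def power_mult_distrib power_inverse power_divide)

lemma frob_0 [simp]: "frob 0 = 0" by simp
lemma frob_1 [simp]: "frob 1 = 1" by (simp add: frob_def)

lemma frob_minus [simp]: "frob (- x) = - frob x"
  using frob_add[of x "- x"] by (simp del: frob_add add: add_eq_0_iff)

lemma frob_diff [simp]: "frob (x - y) = frob x - frob y"
  using frob_add[of x "- y"] by (simp del: frob_add)

lemma frob_sum: "frob (sum f A) = (\<Sum>x\<in>A. frob (f x))"
  by (induction A rule: infinite_finite_induct) simp_all

lemma inj_frob: "inj (frob :: 'a::{finite,field} alg_closure \<Rightarrow> _)"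
proof (rule injI)
  fix x y :: "'a alg_closure"
  assume "frob x = frob y"
  then have "frob (x - y) = 0" by simp
  then show "x = y" by (simp del: frob_diff)
qed

lemma frob_eq_iff [simp]: "frob x = frob y \<longleftrightarrow> x = y"
  using inj_frob by (auto dest: injD)

text \<open>The fixed points are the roots of X^q - X, and F_q already supplies q of them.\<close>

lemma frob_fixed_imp_range:
  fixes x :: "'a::{finite,field} alg_closure"
  assumes "frob x = x"
  shows "x \<in> range to_ac"
proof -
  define P :: "'a alg_closure poly" where "P = monom 1 CARD('a) + [:0,-1:]"
  have card: "CARD('a) > 1"
    using card_mono[OF finite, of "{0,1::'a}" UNIV] by (simp add: card_insert_if)
  have deg: "degree P = CARD('a)"
    unfolding P_def using card by (subst degree_add_eq_left) (auto simp: degree_monom_eq)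
  then have "P \<noteq> 0" using card by auto
  have P: "poly P z = frob z - z" for z by (simp add: P_def poly_monom frob_def)
  have fin: "finite {z. poly P z = 0}" using \<open>P \<noteq> 0\<close> by (rule poly_roots_finite)
  have "range to_ac = {z. poly P z = 0}"
    by (rule card_seteq[OF fin]) (use card_poly_roots_bound[OF \<open>P \<noteq> 0\<close>] in
        \<open>auto simp: P card_range_to_ac deg\<close>)
  then show ?thesis using assms by (simp add: P)
qed

section \<open>Roots of unity of exponent q^2 - q + 1 and chord forms\<close>

lemma card_roots_of_unity_alg_closed:
  assumes "of_nat n \<noteq> (0::'b::alg_closed_field)" 
  shows "card {x::'b. x ^ n = 1} = n"
proof -
  have n: "n > 0" using assms by (cases n) auto
  define P :: "'b poly" where "P = monom 1 n + [:-1:]"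
  have deg: "degree P = n"
    unfolding P_def using n by (subst degree_add_eq_left) (auto simp: degree_monom_eq)
  have "P \<noteq> 0" using deg n by auto
  have P: "poly P z = z ^ n - 1" for z by (simp add: P_def poly_monom)
  from alg_closed_imp_factorization[OF \<open>P \<noteq> 0\<close>] obtain A c
    where A: "size A = degree P" "P = smult c (\<Prod>x\<in>#A. [:-x, 1:])" by blast
  \<comment> \<open>Separability: a double root would also be a root of the derivative n X^(n-1),
    hence 0, but 0 is not a root of X^n - 1.\<close>
  have "count A x \<le> 1" for x
  proof (rule ccontr)
    assume "\<not> count A x \<le> 1"
    then have "{#x,x#} \<subseteq># A"
      by (auto simp: subseteq_mset_def)
    then obtain B where "A = B + {#x,x#}" using subset_mset.le_iff_add[of "{#x,x#}" A] by (auto simp: add.commute)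
    then have Q: "P = [:-x,1:] * ([:-x,1:] * smult c (\<Prod>x\<in>#B. [:-x, 1:]))"
      by (simp only: A(2) mult_smult_right) simp
    have "poly P x = 0" by (simp add: Q)
    moreover have "poly (pderiv P) x = 0"
      by (simp only: Q pderiv_mult poly_add poly_mult) simp
    then have "of_nat n * x ^ (n - 1) = 0"
      by (simp add: P_def pderiv_add pderiv_monom poly_monom pderiv_pCons)
    ultimately show False using assms n by (auto simp: P power_0_left)
  qed
  then have "A = mset_set (set_mset A)"
    by (intro multiset_eqI) (auto simp: count_mset_set' le_Suc_eq count_eq_zero_iff)
  then have "card (set_mset A) = n" using A(1) deg by (metis size_mset_set)
  moreover have "set_mset A = {x. poly P x = 0}"
    using \<open>P \<noteq> 0\<close> A(2) by (cases "c = 0") (auto simp: poly_prod_mset prod_mset_zero_iff)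
  ultimately show ?thesis by (simp add: P)
qed

text \<open>The exponent is the sixth cyclotomic polynomial at q. It divides q^3 + 1, so the cube of
  the Frobenius map inverts the group.\<close>

definition mu :: "'a::{finite,field} alg_closure set" where
  "mu = {x. x ^ (CARD('a)\<^sup>2 - CARD('a) + 1) = 1}"

lemma card_mu: "card (mu :: 'a::{finite,field} alg_closure set) = CARD('a)\<^sup>2 - CARD('a) + 1"
proof -
  have "of_nat CARD('a) = (0 :: 'a alg_closure)"
    by (metis of_nat_card_finite_field to_ac_0 to_ac_of_nat)
  moreover have "CARD('a) \<le> CARD('a)\<^sup>2" by (simp add: power2_eq_square)
  ultimately have "of_nat (CARD('a)\<^sup>2 - CARD('a) + 1) = (1 :: 'a alg_closure)"
    by (simp add: of_nat_diff)
  then show ?thesis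
    unfolding mu_def by (intro card_roots_of_unity_alg_closed) simp
qed

lemma finite_mu [simp]: "finite mu"
  by (rule card_ge_0_finite) (simp add: card_mu)

lemma mu_nonzero: "x \<in> mu \<Longrightarrow> x \<noteq> 0"
  by (auto simp: mu_def)

lemma one_in_mu [simp]: "1 \<in> mu"
  by (simp add: mu_def)

lemma mu_mult: "x \<in> mu \<Longrightarrow> y \<in> mu \<Longrightarrow> x * y \<in> mu"
  and mu_inverse: "x \<in> mu \<Longrightarrow> inverse x \<in> mu"
  by (simp_all only: mu_def mem_Collect_eq power_mult_distrib power_inverse) simp_all

lemma mu_power: "x \<in> mu \<Longrightarrow> x ^ n \<in> mu"
  by (induction n) (simp_all add: mu_mult)

text \<open>This is q^2 = q - 1 modulo the exponent. The rule alone turns every Frobenius iterate of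
  \<open>x\<close> into a monomial in \<open>x\<close> and \<open>frob x\<close>.\<close>

lemma frob_frob_mu:
  fixes x :: "'a::{finite,field} alg_closure"
  assumes "x \<in> mu"
  shows "frob (frob x) = frob x / x"
proof -
  have "CARD('a) \<le> CARD('a)\<^sup>2" by (simp add: power2_eq_square)
  then have "CARD('a) * CARD('a) + 1 = CARD('a) + (CARD('a)\<^sup>2 - CARD('a) + 1)"
    by (simp add: power2_eq_square)
  then have "x ^ (CARD('a) * CARD('a)) * x = x ^ CARD('a) * x ^ (CARD('a)\<^sup>2 - CARD('a) + 1)"
    by (metis power_add power_one_right)
  then show ?thesis
    using assms mu_nonzero[OF assms] by (simp add: frob_def mu_def field_simps flip: power_mult)
qed

text \<open>A determinant testing whether (x - a) / (b - a) is fixed by \<open>frob\<close>: for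
  distinct \<open>a\<close> and \<open>b\<close> its zeros form the F_q-line through them.\<close>

definition chord :: "'a::{finite,field} alg_closure \<Rightarrow> 'a alg_closure \<Rightarrow> 'a alg_closure \<Rightarrow> 'a alg_closure" where
  "chord a b x = (b - a) * frob (x - a) - (x - a) * frob (b - a)"

text \<open>If the chord form vanishes then \<open>x - a = t (b - a)\<close> with \<open>t\<close> in \<open>\<F>\<^sub>q\<close>. The cube of the
  Frobenius map inverts the elements of \<^term>\<open>mu\<close>, and comparing both equations gives \<open>x = b\<close>.\<close>
lemma chord_nonzero:
  assumes "a \<in> mu" "b \<in> mu" "x \<in> mu" "a \<noteq> b" "x \<noteq> a" "x \<noteq> b"
  shows "chord a b x \<noteq> 0"
proof
  assume 0: "chord a b x = 0"
  define t where "t = (x - a) / (b - a)"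
  have t: "frob t = t"
    using 0 assms by (simp add: t_def chord_def frac_eq_eq mult.commute flip: frob_diff)
  have cube: "frob (frob (frob y)) = 1 / y" if "y \<in> mu" for y
    using that mu_nonzero[OF that] by (simp add: frob_frob_mu)
  have "x - a = t * (b - a)" using assms by (simp add: t_def)
  then have "frob (frob (frob (x - a))) = t * frob (frob (frob (b - a)))"
    by (metis frob_mult t)
  then have "1 / x - 1 / a = t * (1 / b - 1 / a)"
    using assms by (simp add: cube)
  then have "a * ((x - a) * b) = a * (t * (b - a) * x)"
    using mu_nonzero[OF assms(1)] mu_nonzero[OF assms(2)] mu_nonzero[OF assms(3)]
    by (simp add: field_simps)
  then have "(x - a) * b = t * (b - a) * x"
    using mu_nonzero[OF assms(1)] by simp
  then have "(x - a) * b = (x - a) * x"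
    using \<open>x - a = t * (b - a)\<close> by simp
  then show False using assms by simp
qed

lemma chord_self [simp]: "chord a b a = 0" "chord a b b = 0"
  by (simp_all add: chord_def)

section \<open>Trace forms and their common zeros\<close>

lemma resultant_quadratics:
  fixes x :: "'b::field"
  assumes "a * x\<^sup>2 + b * x + c = 0" "a' * x\<^sup>2 + b' * x + c' = 0" "x \<noteq> 0"
  shows "(a * c' - c * a')\<^sup>2 = (a * b' - b * a') * (b * c' - c * b')"
proof -
  \<comment> \<open>Eliminating the leading terms, and then the constant terms, leaves two linear
    relations in \<open>x\<close>; together they remove \<open>x\<close>.\<close>
  have "(a * b' - b * a') * x + (a * c' - c * a')
      = a * (a' * x\<^sup>2 + b' * x + c') - a' * (a * x\<^sup>2 + b * x + c)"
    by (simp add: algebra_simps)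
  then have 1: "(a * b' - b * a') * x = - (a * c' - c * a')"
    using assms(1,2) by (simp add: add_eq_0_iff2)
  have "((a * c' - c * a') * x + (b * c' - c * b')) * x
      = c' * (a * x\<^sup>2 + b * x + c) - c * (a' * x\<^sup>2 + b' * x + c')"
    by (simp add: algebra_simps power2_eq_square)
  then have "((a * c' - c * a') * x + (b * c' - c * b')) * x = 0"
    using assms(1,2) by simp
  then have 2: "b * c' - c * b' = - ((a * c' - c * a') * x)"
    using assms(3) by (simp add: add_eq_0_iff)
  have "(a * c' - c * a')\<^sup>2 = - ((a * b' - b * a') * x) * (a * c' - c * a')"
    unfolding 1 by (simp add: power2_eq_square)
  also have "\<dots> = (a * b' - b * a') * (b * c' - c * b')"
    unfolding 2 by simp
  finally show ?thesis .
qed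

text \<open>The field trace to F_q on the subfield of q^6 elements; elsewhere in \<open>K\<close> it
  is only an F_q-linear map.\<close>

definition tr :: "'a::{finite,field} alg_closure \<Rightarrow> 'a alg_closure" where
  "tr z = (\<Sum>k<6. (frob ^^ k) z)"

lemma funpow_frob_mult: "(frob ^^ k) (x * y) = (frob ^^ k) x * (frob ^^ k) y"
  and funpow_frob_add: "(frob ^^ k) (x + y) = (frob ^^ k) x + (frob ^^ k) y"
  and funpow_frob_power: "(frob ^^ k) (x ^ n) = (frob ^^ k) x ^ n"
  and funpow_frob_to_ac: "(frob ^^ k) (to_ac a) = to_ac a"
  and funpow_frob_0: "(frob ^^ k) 0 = 0"
  by (induction k) simp_all

lemma funpow_frob_sum: "(frob ^^ k) (sum f A) = (\<Sum>x\<in>A. (frob ^^ k) (f x))"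
  by (induction A rule: infinite_finite_induct) (simp_all add: funpow_frob_add funpow_frob_0)

lemma funpow_frob_eq_iff: "(frob ^^ k) x = (frob ^^ k) y \<longleftrightarrow> x = y"
  by (induction k) simp_all

lemma tr_add: "tr (x + y) = tr x + tr y"
  by (simp add: tr_def funpow_frob_add sum.distrib)

lemma tr_0 [simp]: "tr 0 = 0"
  by (simp add: tr_def funpow_frob_0)

lemma tr_sum: "tr (sum f A) = (\<Sum>x\<in>A. tr (f x))"
  by (induction A rule: infinite_finite_induct) (simp_all add: tr_add)

lemma tr_to_ac_mult: "tr (to_ac a * x) = to_ac a * tr x"
  by (simp add: tr_def funpow_frob_mult funpow_frob_to_ac sum_distrib_left)

definition F6 :: "'a::{finite,field} alg_closure set" where
  "F6 = {z. (frob ^^ 6) z = z}"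

lemma mu_subset_F6: "x \<in> mu \<Longrightarrow> x \<in> F6"
  by (simp add: F6_def eval_nat_numeral frob_frob_mu mu_nonzero)

text \<open>The Frobenius map permutes the six summands cyclically, so it fixes the trace.\<close>

lemma tr_in_range_to_ac:
  assumes "x \<in> F6"
  shows "tr x \<in> range to_ac"
proof (rule frob_fixed_imp_range)
  have "frob (tr x) = (\<Sum>k<6. (frob ^^ Suc k) x)"
    by (simp add: tr_def frob_sum)
  also have "\<dots> = (\<Sum>k<6. (frob ^^ k) x)"
    using assms sum.lessThan_Suc_shift[of "\<lambda>k. (frob ^^ k) x" 6]
      sum.lessThan_Suc[of "\<lambda>k. (frob ^^ k) x" 6]
    by (simp add: F6_def del: funpow.simps sum.lessThan_Suc)
  finally show "frob (tr x) = tr x" by (simp add: tr_def)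
qed

text \<open>With \<open>y = x\<^sup>q\<close> every conjugate of \<open>x\<close> is a monomial in \<open>x\<close> and \<open>y\<close>.\<close>
lemma tr_mult_mu:
  assumes "x \<in> mu"
  shows "(c0 + tr (c * x)) * (x * frob x) =
    (c * frob x + (frob ^^ 5) c) * x\<^sup>2
    + (c0 * frob x + frob c * (frob x)\<^sup>2 + (frob ^^ 4) c) * x
    + frob x * ((frob ^^ 2) c * frob x + (frob ^^ 3) c)"
proof -
  define y where "y = frob x"
  have nz: "x \<noteq> 0" "y \<noteq> 0" using assms mu_nonzero by (auto simp: y_def)
  have conj: "(frob ^^ 1) x = y" "(frob ^^ 2) x = y / x" "(frob ^^ 3) x = 1 / x"
      "(frob ^^ 4) x = 1 / y" "(frob ^^ 5) x = x / y"
    using nz by (simp_all add: y_def eval_nat_numeral frob_frob_mu[OF assms])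
  have prods: "y / x * (x * y) = y * y" "1 / x * (x * y) = y" "1 / y * (x * y) = x"
      "x / y * (x * y) = x * x"
    using nz by simp_all
  have six: "{..<6} = {0,1,2,3,4,5::nat}" by auto
  have "tr (c * x) = c * x + frob c * y + (frob ^^ 2) c * (y / x) + (frob ^^ 3) c * (1 / x)
      + (frob ^^ 4) c * (1 / y) + (frob ^^ 5) c * (x / y)"
    by (simp add: tr_def funpow_frob_mult six conj add.assoc flip: y_def)
  then show ?thesis
    unfolding y_def[symmetric] by (simp only: distrib_right mult.assoc prods)
      (simp add: algebra_simps power2_eq_square)
qed

text \<open>The hypothesis expresses independence of \<open>c\<close> and \<open>d\<close> over F_q.
  Distinct zeros \<open>x\<close> yield distinct roots \<open>frob x\<close> of the resultant, so
  its degree bounds their number.\<close>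

lemma card_common_zeros_le_6:
  fixes c d c0 d0 :: "'a::{finite,field} alg_closure"
  assumes "c * frob d \<noteq> d * frob c"
  shows "card {x\<in>mu. c0 + tr (c * x) = 0 \<and> d0 + tr (d * x) = 0} \<le> 6" (is "card ?Z \<le> 6")
proof -
  define A where "A = [:(frob ^^ 5) c, c:]"
  define B where "B = [:(frob ^^ 4) c, c0, frob c:]"
  define C where "C = [:(frob ^^ 3) c, (frob ^^ 2) c:]"
  define A' where "A' = [:(frob ^^ 5) d, d:]"
  define B' where "B' = [:(frob ^^ 4) d, d0, frob d:]"
  define C' where "C' = [:(frob ^^ 3) d, (frob ^^ 2) d:]"
  note defs = A_def B_def C_def A'_def B'_def C'_def
  \<comment> \<open>The constant terms of the quadratics are y C and y C', so y divides their
    resultant; \<open>R\<close> is the cofactor.\<close>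
  define R where "R = [:0, 1:] * (A * C' - C * A')\<^sup>2 - (A * B' - B * A') * (B * C' - C * B')"
  \<comment> \<open>At 0 the resultant splits into two Frobenius conjugates of the determinant that
    the hypothesis makes nonzero.\<close>
  have "poly R 0 = - (frob ^^ 4) (frob c * d - c * frob d) * (frob ^^ 3) (frob c * d - c * frob d)"
    by (simp add: R_def defs eval_nat_numeral algebra_simps)
  moreover have "frob c * d - c * frob d \<noteq> 0" using assms by (simp add: mult.commute)
  ultimately have "R \<noteq> 0"
    using funpow_frob_eq_iff[of _ "frob c * d - c * frob d" 0] by (auto simp: funpow_frob_0)
  have deg: "degree A \<le> 1" "degree A' \<le> 1" "degree C \<le> 1" "degree C' \<le> 1" "degree B \<le> 2" "degree B' \<le> 2"
    by (simp_all add: defs)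
  have "degree (A * C' - C * A') \<le> 2"
    using deg by (intro degree_diff_le) (auto intro!: order.trans[OF degree_mult_le])
  then have "degree ((A * C' - C * A')\<^sup>2) \<le> 4"
    using degree_power_le[of "A * C' - C * A'" 2] by simp
  then have "degree ([:0, 1:] * (A * C' - C * A')\<^sup>2) \<le> 6"
    by (auto intro!: order.trans[OF degree_mult_le])
  moreover have "degree (A * B' - B * A') \<le> 3" "degree (B * C' - C * B') \<le> 3"
    using deg by (auto intro!: degree_diff_le order.trans[OF degree_mult_le])
  then have "degree ((A * B' - B * A') * (B * C' - C * B')) \<le> 6"
    by (auto intro!: order.trans[OF degree_mult_le])
  ultimately have "degree R \<le> 6"
    unfolding R_def by (rule degree_diff_le)
  have "poly R (frob x) = 0" if "x \<in> ?Z" for x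
  proof -
    define y where "y = frob x"
    have "x \<noteq> 0" "y \<noteq> 0" using that mu_nonzero by (auto simp: y_def)
    have "poly A y * x\<^sup>2 + poly B y * x + y * poly C y = 0"
      using that tr_mult_mu[of x c0 c]
      by (simp add: defs y_def algebra_simps power2_eq_square)
    moreover have "poly A' y * x\<^sup>2 + poly B' y * x + y * poly C' y = 0"
      using that tr_mult_mu[of x d0 d]
      by (simp add: defs y_def algebra_simps power2_eq_square)
    ultimately have "y * poly R y = 0"
      using resultant_quadratics[of "poly A y" x "poly B y" "y * poly C y" "poly A' y" "poly B' y" "y * poly C' y"] \<open>x \<noteq> 0\<close>
      by (simp add: R_def algebra_simps power2_eq_square)
    then show ?thesis using \<open>y \<noteq> 0\<close> by (simp add: y_def)
  qed
  then have "frob ` ?Z \<subseteq> {y. poly R y = 0}" by auto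
  then have "card (frob ` ?Z) \<le> card {y. poly R y = 0}"
    using poly_roots_finite[OF \<open>R \<noteq> 0\<close>] by (intro card_mono)
  also have "\<dots> \<le> 6" using card_poly_roots_bound[OF \<open>R \<noteq> 0\<close>] \<open>degree R \<le> 6\<close> by simp
  finally show ?thesis by (simp add: card_image inj_on_def)
qed

section \<open>Independence of conjugates\<close>

lemma vandermonde_zero:
  fixes t z :: "nat \<Rightarrow> 'b::field"
  assumes inj: "inj_on t {..<n}" and rel: "\<And>j. j < n \<Longrightarrow> (\<Sum>k<n. z k * t k ^ j) = 0"
    and i: "i < n"
  shows "z i = 0"
proof -
  \<comment> \<open>The Lagrange polynomial of node \<open>i\<close>: combining the relations with
    its coefficients isolates \<open>z i\<close>.\<close>
  define p where "p = (\<Prod>k\<in>{..<n} - {i}. [:- t k, 1:])"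
  have "degree p = n - 1" using i by (simp add: p_def degree_prod_eq_sum_degree)
  then have "degree p < n" using i by simp
  have "(\<Sum>k<n. z k * poly p (t k)) = (\<Sum>k<n. \<Sum>j\<le>degree p. coeff p j * (z k * t k ^ j))"
    by (simp add: poly_altdef sum_distrib_left mult_ac)
  also have "\<dots> = (\<Sum>j\<le>degree p. coeff p j * (\<Sum>k<n. z k * t k ^ j))"
    by (subst sum.swap) (simp add: sum_distrib_left)
  also have "\<dots> = 0" using rel \<open>degree p < n\<close> by simp
  finally have "(\<Sum>k<n. z k * poly p (t k)) = 0" .
  moreover have "(\<Sum>k<n. z k * poly p (t k)) = (\<Sum>k\<in>{i}. z k * poly p (t k))"
    using i by (intro sum.mono_neutral_right) (auto simp: p_def poly_prod)
  moreover have "poly p (t i) \<noteq> 0"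
    using inj i by (auto simp: p_def poly_prod inj_on_def)
  ultimately show ?thesis by simp
qed

text \<open>By \<open>frob_frob_mu\<close>, a coincidence at shift 1, 2 or 3 forces \<theta> = 1,
  \<theta>^3 = 1 or \<theta>^2 = 1. Shifts 4 and 5 reduce to 2 and 1, as the sixth iterate fixes
  \<theta>.\<close>

lemma inj_on_conjugates:
  assumes "\<theta> \<in> mu" "\<theta> ^ 3 \<noteq> 1"
  shows "inj_on (\<lambda>k. (frob ^^ k) \<theta>) {..<6}"
proof -
  have nz [simp]: "\<theta> \<noteq> 0" using assms mu_nonzero by auto
  note ff = frob_frob_mu[OF assms(1)]
  have 1: "frob \<theta> \<noteq> \<theta>"
  proof
    assume "frob \<theta> = \<theta>"
    with ff have "\<theta> = 1" by simp
    then show False using assms by simp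
  qed
  have 2: "frob (frob \<theta>) \<noteq> \<theta>"
  proof
    assume *: "frob (frob \<theta>) = \<theta>"
    then have y: "frob \<theta> = \<theta> ^ 2" using ff by (simp add: field_simps power2_eq_square)
    then have "(\<theta> ^ 2) ^ 2 = \<theta>" using * by simp
    then have "\<theta> ^ 3 * \<theta> = 1 * \<theta>" by (simp flip: power_mult power_Suc2)
    then show False using assms by simp
  qed
  have 3: "frob (frob (frob \<theta>)) \<noteq> \<theta>"
  proof
    assume *: "frob (frob (frob \<theta>)) = \<theta>"
    then have "\<theta> ^ 2 = 1" using ff by (simp add: field_simps power2_eq_square)
    then have "\<theta> = 1 \<or> \<theta> = -1" by (simp add: power2_eq_1_iff)
    then have "frob \<theta> = \<theta>" by auto
    with 1 show False by simp
  qed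
  have "(frob ^^ d) \<theta> \<noteq> \<theta>" if "0 < d" "d < 6" for d
  proof -
    have "d \<in> {1,2,3,4,5}" using that by auto
    moreover have six: "(frob ^^ 6) \<theta> = \<theta>" using mu_subset_F6 assms by (auto simp: F6_def)
    have "(frob ^^ 4) \<theta> \<noteq> \<theta>"
    proof
      assume "(frob ^^ 4) \<theta> = \<theta>"
      then have "(frob ^^ 2) \<theta> = (frob ^^ (2+4)) \<theta>" by (simp only: funpow_add o_def)
      then show False using six 2 by (simp add: numeral_2_eq_2)
    qed
    moreover have "(frob ^^ 5) \<theta> \<noteq> \<theta>"
    proof
      assume "(frob ^^ 5) \<theta> = \<theta>"
      then have "(frob ^^ 1) \<theta> = (frob ^^ (1+5)) \<theta>" by (simp only: funpow_add o_def)
      then show False using six 1 by simp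
    qed
    ultimately show ?thesis using 1 2 3 by (auto simp: numeral_2_eq_2 numeral_3_eq_3)
  qed
  then have *: "(frob ^^ j) \<theta> \<noteq> (frob ^^ i) \<theta>" if "i < j" "j < 6" for i j
    using that funpow_frob_eq_iff[of i "(frob ^^ (j - i)) \<theta>" \<theta>]
    by (simp add: funpow_add[symmetric, THEN fun_cong, unfolded o_def])
  show ?thesis
    by (rule inj_onI) (metis * lessThan_iff linorder_neqE_nat)
qed

section \<open>Linear functionals and subspaces of a coordinate space\<close>

definition dotp :: "'a::field ^ 'n \<Rightarrow> 'a ^ 'n \<Rightarrow> 'a" where
  "dotp a w = (\<Sum>i\<in>UNIV. a $ i * w $ i)"

lemma exists_annihilating_functional:
  fixes W :: "('a::field ^ 'n) set"
  assumes "vec.subspace W" "x \<notin> W"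
  obtains a :: "'a ^ 'n" where "\<And>w. w \<in> W \<Longrightarrow> dotp a w = 0" and "dotp a x = 1"
proof -
  obtain B where B: "B \<subseteq> W" "vec.independent B" "W \<subseteq> vec.span B"
    using vec.maximal_independent_subset[of W] by metis
  have "W = vec.span B"
    using B assms(1) by (simp add: subset_antisym vec.span_minimal)
  then have "vec.independent (insert x B)"
    using B(2) assms(2) vec.independent_insertI by blast
  then obtain g :: "'a ^ 'n \<Rightarrow> 'a ^ 'n" where lin: "Vector_Spaces.linear (*s) (*s) g"
    and g: "\<forall>y\<in>insert x B. g y = (if y = x then 1 else 0)"
    using vec.linear_independent_extend[of "insert x B" "\<lambda>y. if y = x then 1 else 0"] by blast
  \<comment> \<open>The vector \<open>1\<close> has all coordinates one, so any single row of the
    matrix of \<open>g\<close> is a suitable functional.\<close>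
  fix k :: 'n
  define a where "a = matrix g $ k"
  have a: "dotp a w = g w $ k" for w
    by (subst matrix_works[OF lin, symmetric]) (simp add: a_def dotp_def matrix_vector_mult_def)
  have "x \<notin> B" using B(1) assms(2) by blast
  then have "\<forall>y\<in>B. g y = 0" using g by auto
  then have "g w = 0" if "w \<in> W" for w
    using vec.linear_eq_0_on_span[OF lin] that \<open>W = vec.span B\<close> by blast
  then show thesis using that[of a] g by (simp add: a)
qed

lemma dotp_add_left: "dotp (a + b) w = dotp a w + dotp b w"
  and dotp_diff_left: "dotp (a - b) w = dotp a w - dotp b w"
  and dotp_scale_left: "dotp (c *s a) w = c * dotp a w"
  and dotp_add_right: "dotp a (v + w) = dotp a v + dotp a w"
  and dotp_scale_right: "dotp a (c *s w) = c * dotp a w"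
  and dotp_0_left: "dotp 0 w = 0"
  and dotp_0_right: "dotp a 0 = 0"
  by (simp_all add: dotp_def algebra_simps sum.distrib sum_subtractf sum_distrib_left)

lemma subspace_dotp_eq_0: "vec.subspace {w. dotp a w = 0}"
  by (intro vec.subspaceI) (simp_all add: dotp_add_right dotp_scale_right dotp_0_right)

text \<open>There is room for \<open>x\<close> outside \<open>W\<close> and \<open>y\<close> outside
  the span of \<open>W\<close> and \<open>x\<close>. Since \<open>a\<close> kills \<open>x\<close>
  but not \<open>y\<close>, and \<open>b\<close> does not kill \<open>x\<close>, evaluation at
  \<open>x\<close> and then at \<open>y\<close> shows independence.\<close>

lemma exists_two_annihilating_functionals:
  fixes W :: "('a::field ^ 'n) set"
  assumes "vec.subspace W" "vec.dim W + 2 \<le> CARD('n)"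
  obtains a b :: "'a ^ 'n" where "\<And>w. w \<in> W \<Longrightarrow> dotp a w = 0" "\<And>w. w \<in> W \<Longrightarrow> dotp b w = 0"
    and "\<And>s t. s *s a + t *s b = 0 \<Longrightarrow> s = 0 \<and> t = 0"
proof -
  have full: "vec.dim (UNIV :: ('a ^ 'n) set) = CARD('n)" by (rule vec_dim_card)
  then have "vec.dim W \<noteq> vec.dim (UNIV :: ('a ^ 'n) set)" using assms(2) by linarith
  then have "W \<noteq> UNIV" by metis
  then obtain x where x: "x \<notin> W" by blast
  have "vec.dim (vec.span (insert x W)) \<le> Suc (vec.dim W)"
    using vec.dim_insert[of x W] by simp
  then have "vec.dim (vec.span (insert x W)) \<noteq> vec.dim (UNIV :: ('a ^ 'n) set)"
    using assms(2) full by linarith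
  then have "vec.span (insert x W) \<noteq> UNIV" by metis
  then obtain y where y: "y \<notin> vec.span (insert x W)" by blast
  obtain a where a: "\<And>w. w \<in> vec.span (insert x W) \<Longrightarrow> dotp a w = 0" "dotp a y = 1"
    using exists_annihilating_functional[OF vec.subspace_span y] by blast
  obtain b where b: "\<And>w. w \<in> W \<Longrightarrow> dotp b w = 0" "dotp b x = 1"
    using exists_annihilating_functional[OF assms(1) x] by blast
  have ax: "dotp a x = 0" and aW: "\<And>w. w \<in> W \<Longrightarrow> dotp a w = 0"
    by (auto intro!: a(1) vec.span_base)
  have "s = 0 \<and> t = 0" if "s *s a + t *s b = 0" for s t
  proof -
    have *: "s * dotp a w + t * dotp b w = 0" for w
      using that by (metis dotp_add_left dotp_scale_left dotp_0_left)
    have "t = 0" using *[of x] ax b(2) by simp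
    then show ?thesis using *[of y] a(2) by simp
  qed
  then show thesis using that aW b(1) by blast
qed

lemma exists_superspace_dim:
  fixes S :: "('a::field ^ 'n) set"
  assumes "vec.dim S \<le> d" "d \<le> CARD('n)"
  obtains W where "vec.subspace W" "S \<subseteq> W" "vec.dim W = d"
proof -
  obtain B where B: "B \<subseteq> S" "vec.independent B" "S \<subseteq> vec.span B" "card B = vec.dim S"
    using vec.basis_exists[of S] by metis
  obtain D where D: "B \<subseteq> D" "vec.independent D" "UNIV \<subseteq> vec.span D"
    using vec.maximal_independent_subset_extend[of B UNIV] B(2) by auto
  have fD: "finite D" using D(2) vec.finiteI_independent by blast
  have "card D = CARD('n)"
    using vec.dim_eq_card[of D UNIV] D by (metis subset_antisym top_greatest vec_dim_card vec.span_UNIV)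
  then obtain C where C: "B \<subseteq> C" "C \<subseteq> D" "card C = d"
    using exists_subset_between[of B d D] B(4) assms D(1) fD by auto
  have "vec.independent C" using C(2) D(2) vec.independent_mono by blast
  then have "vec.dim (vec.span C) = d" using C(3) by (simp add: vec.dim_eq_card_independent)
  moreover have "S \<subseteq> vec.span C" using B(3) C(1) vec.span_mono by blast
  ultimately show thesis using that[of "vec.span C"] by simp
qed

lemma proj_point_subset_iff:
  assumes "vec.subspace W"
  shows "proj_point v \<subseteq> W \<longleftrightarrow> v \<in> W"
proof
  assume "proj_point v \<subseteq> W"
  moreover have "1 *s v \<in> proj_point v" unfolding proj_point_def using one_neq_zero by blast
  ultimately show "v \<in> W" by auto
next
  assume "v \<in> W"
  then show "proj_point v \<subseteq> W"
    using assms vec.subspace_scale by (auto simp: proj_point_def)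
qed

section \<open>The points in trace coordinates and their linear relations\<close>

lemma card_mu_ge:
  assumes "CARD('a::{finite,field}) \<ge> 4"
  shows "card (mu :: 'a alg_closure set) \<ge> 13"
proof -
  obtain k where k: "CARD('a) = k + 4" using assms by (metis add.commute le_Suc_ex)
  show ?thesis unfolding card_mu k by (simp add: power2_eq_square algebra_simps)
qed

text \<open>The map \<open>e\<close> labels the coordinates other than 0 by the exponents 0 to 5.
  The cube condition gives \<theta> six distinct conjugates, so these powers of \<theta> form a
  basis of \<open>F6\<close> over F_q.\<close>

locale hermitian_points =
  fixes \<theta> :: "'a::{finite,field} alg_closure" and e :: "7 \<Rightarrow> nat"
  assumes theta_mu: "\<theta> \<in> mu" and theta_cube: "\<theta> ^ 3 \<noteq> 1"
    and bij_e: "bij_betw e (UNIV - {0}) {..<6}"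
    and card_ge: "CARD('a) \<ge> 4"
begin

definition pt :: "'a alg_closure \<Rightarrow> 'a ^ 7" where
  "pt x = (\<chi> i. if i = 0 then 1 else of_ac (tr (\<theta> ^ e i * x)))"

lemma pt_0 [simp]: "pt x $ 0 = 1"
  by (simp add: pt_def)

lemma to_ac_pt:
  assumes "x \<in> mu" "i \<noteq> 0"
  shows "to_ac (pt x $ i) = tr (\<theta> ^ e i * x)"
proof -
  have "tr (\<theta> ^ e i * x) \<in> range to_ac"
    by (intro tr_in_range_to_ac mu_subset_F6 mu_mult mu_power theta_mu assms)
  then show ?thesis using assms by (simp add: pt_def to_ac_of_ac)
qed

text \<open>Nondegeneracy of the trace form: the six traces are a Vandermonde system in the
  conjugates of \<open>z\<close>.\<close>

lemma eq_0_if_traces_eq_0: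
  assumes "\<And>j. j < 6 \<Longrightarrow> tr (\<theta> ^ j * z) = 0"
  shows "z = 0"
proof -
  have "(\<Sum>k<6. (frob ^^ k) z * (frob ^^ k) \<theta> ^ j) = 0" if "j < 6" for j
    using assms[OF that] by (simp add: tr_def funpow_frob_mult funpow_frob_power mult.commute)
  from vandermonde_zero[OF inj_on_conjugates[OF theta_mu theta_cube] this, of 0] show ?thesis by simp
qed

text \<open>Dependence of points becomes affine dependence over F_q inside \<open>K\<close>:
  coordinate 0 sees the sum of the coefficients, and the other six determine the combination of the
  \<open>g i\<close>. Indexed families allow repeated points.\<close>

lemma pt_relation_iff:
  assumes "\<And>i. i \<in> I \<Longrightarrow> g i \<in> mu"
  shows "(\<Sum>i\<in>I. l i *s pt (g i)) = 0 \<longleftrightarrow> (\<Sum>i\<in>I. l i) = 0 \<and> (\<Sum>i\<in>I. to_ac (l i) * g i) = 0"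
    (is "?v = 0 \<longleftrightarrow> _ \<and> ?z = 0")
proof -
  have v0: "?v $ 0 = (\<Sum>i\<in>I. l i)" by simp
  have v: "to_ac (?v $ k) = tr (\<theta> ^ e k * ?z)" if "k \<noteq> 0" for k
  proof -
    have "to_ac (?v $ k) = (\<Sum>i\<in>I. to_ac (l i) * tr (\<theta> ^ e k * g i))"
      using assms that by (simp add: to_ac_sum to_ac_pt)
    also have "\<dots> = tr (\<Sum>i\<in>I. to_ac (l i) * (\<theta> ^ e k * g i))"
      by (simp add: tr_sum tr_to_ac_mult)
    also have "(\<Sum>i\<in>I. to_ac (l i) * (\<theta> ^ e k * g i)) = \<theta> ^ e k * ?z"
      unfolding sum_distrib_left by (rule sum.cong) (simp_all only: mult.left_commute)
    finally show ?thesis .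
  qed
  show ?thesis
  proof
    assume 0: "?v = 0"
    have "tr (\<theta> ^ j * ?z) = 0" if "j < 6" for j
    proof -
      have "j \<in> e ` (UNIV - {0})"
        unfolding bij_betw_imp_surj_on[OF bij_e] using that by simp
      then obtain k where "k \<noteq> 0" "e k = j" by blast
      then show ?thesis using v[of k] 0 by simp
    qed
    then have "?z = 0" by (rule eq_0_if_traces_eq_0)
    with v0 0 show "(\<Sum>i\<in>I. l i) = 0 \<and> ?z = 0" by simp
  next
    assume 0: "(\<Sum>i\<in>I. l i) = 0 \<and> ?z = 0"
    have "?v $ k = 0" for k
      using v0 v[of k] 0 by (cases "k = 0") (auto simp del: sum_component)
    then show "?v = 0" by (simp add: vec_eq_iff)
  qed
qed

lemma inj_on_pt: "inj_on pt mu"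
proof (rule inj_onI)
  fix x y assume xy: "x \<in> mu" "y \<in> mu" "pt x = pt y"
  show "x = y"
  proof (rule ccontr)
    assume "x \<noteq> y"
    then have "(\<Sum>i\<in>{x,y}. (if i = x then 1 else -1) *s pt i) = 0" using xy by simp
    then have "(\<Sum>i\<in>{x,y}. to_ac (if i = x then 1 else -1) * i) = 0"
      using xy pt_relation_iff[of "{x,y}" "\<lambda>i. i" "\<lambda>i. if i = x then 1 else -1"] by auto
    then show False using \<open>x \<noteq> y\<close> by simp
  qed
qed

text \<open>The product of a chord form in \<open>x\<close> and one in \<open>1 / x\<close> is a linear combination of \<open>1\<close> and
  the six conjugates of \<open>x\<close>, and it vanishes on \<^term>\<open>mu\<close> at exactly four points.\<close>
lemma relation_le_5_trivial:
  assumes S: "S \<subseteq> mu" "card S \<le> 5"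
    and l: "(\<Sum>x\<in>S. l x) = 0" "(\<Sum>x\<in>S. to_ac (l x) * x) = (0 :: 'a alg_closure)"
    and z: "z \<in> S"
  shows "l z = 0"
proof -
  have fin: "finite S" using S(1) finite_mu finite_subset by blast
  have "card (S - {z}) \<le> 4" "4 \<le> card (mu - {z})"
    using S z card_mu_ge[OF card_ge] by (auto simp: card_Diff_singleton_if fin)
  \<comment> \<open>Padding to exactly four points lets them be split into two genuine
    chords.\<close>
  then obtain T where T: "S - {z} \<subseteq> T" "T \<subseteq> mu - {z}" "card T = 4"
    using exists_subset_between[of "S - {z}" 4 "mu - {z}"] S(1) by auto
  then obtain a b c d where abcd: "T = {a,b,c,d}" "a \<noteq> b" "c \<noteq> d"
    by (auto simp: card_Suc_eq eval_nat_numeral)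
  define F where "F x = chord a b x * chord (inverse c) (inverse d) (inverse x)" for x
  have inv: "inverse c \<noteq> inverse d" "inverse z \<noteq> inverse c" "inverse z \<noteq> inverse d"
    using abcd T by auto
  have "F z \<noteq> 0"
    unfolding F_def mult_eq_0_iff de_Morgan_disj
    using abcd T S(1) z inv by (intro conjI chord_nonzero) (auto simp: mu_inverse)
  have F0: "F x = 0" if "x \<in> S" "x \<noteq> z" for x
    using that T(1) abcd(1) by (auto simp: F_def)
  define A B C where "A = b - a" and "B = - frob (b - a)" and "C = a * frob (b - a) - (b - a) * frob a"
  define A' B' C' where "A' = inverse d - inverse c" and "B' = - frob (inverse d - inverse c)"
    and "C' = inverse c * frob (inverse d - inverse c) - (inverse d - inverse c) * frob (inverse c)"
  \<comment> \<open>Of the nine products of terms, three are constant and the other six give one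
    Frobenius iterate of \<open>x\<close> each.\<close>
  have F: "F x = (A * A' + B * B' + C * C') + B * C' * x + A * C' * frob x + A * B' * frob (frob x)
      + C * B' * frob (frob (frob x)) + C * A' * frob (frob (frob (frob x)))
      + B * A' * frob (frob (frob (frob (frob x))))" if "x \<in> mu" for x
  proof -
    define y where "y = frob x"
    have nz: "x \<noteq> 0" "y \<noteq> 0" using that mu_nonzero by (auto simp: y_def)
    have "chord a b x = A * y + B * x + C"
      by (simp add: chord_def A_def B_def C_def y_def algebra_simps)
    moreover have "chord (inverse c) (inverse d) (inverse x) = A' * inverse y + B' * inverse x + C'"
      by (simp add: chord_def A'_def B'_def C'_def y_def algebra_simps)
    ultimately have Fx: "F x = (A * y + B * x + C) * (A' * inverse y + B' * inverse x + C')"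
      by (simp add: F_def)
    have conj: "frob y = y * inverse x" "frob (y * inverse x) = inverse x"
        "frob (inverse x) = inverse y" "frob (inverse y) = x * inverse y"
      using nz frob_frob_mu[OF that] by (simp_all add: y_def divide_inverse)
    define x' y' where "x' = inverse x" and "y' = inverse y"
    have inv: "x' * x = 1" "y' * y = 1" using nz by (simp_all add: x'_def y'_def)
    show ?thesis
      unfolding y_def[symmetric] conj Fx unfolding x'_def[symmetric] y'_def[symmetric]
      by (simp add: algebra_simps inv)
  qed
  \<comment> \<open>The coefficients lie in F_q, so applying \<open>frob\<close> to the relation
    gives a relation with the same coefficients.\<close>
  have sum0: "(\<Sum>x\<in>S. to_ac (l x) * (frob ^^ k) x) = 0" for k
    using arg_cong[OF l(2), of "frob ^^ k"]
    by (simp add: funpow_frob_sum funpow_frob_mult funpow_frob_to_ac funpow_frob_0)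
  have l0: "(\<Sum>x\<in>S. to_ac (l x)) = 0" using l(1) by (simp flip: to_ac_sum)
  have "(\<Sum>x\<in>S. to_ac (l x) * F x) = (\<Sum>x\<in>S. (A * A' + B * B' + C * C') * to_ac (l x)
      + B * C' * (to_ac (l x) * x) + A * C' * (to_ac (l x) * frob x)
      + A * B' * (to_ac (l x) * frob (frob x)) + C * B' * (to_ac (l x) * frob (frob (frob x)))
      + C * A' * (to_ac (l x) * frob (frob (frob (frob x))))
      + B * A' * (to_ac (l x) * frob (frob (frob (frob (frob x))))))"
    using S(1) by (intro sum.cong refl, subst F) (auto simp: algebra_simps)
  also have "\<dots> = 0"
    using l0 l(2) sum0[of 1] sum0[of 2] sum0[of 3] sum0[of 4] sum0[of 5]
    by (simp add: sum.distrib eval_nat_numeral flip: sum_distrib_left)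
  finally have "(\<Sum>x\<in>S. to_ac (l x) * F x) = 0" .
  moreover have "(\<Sum>x\<in>S. to_ac (l x) * F x) = (\<Sum>x\<in>{z}. to_ac (l x) * F x)"
    using F0 z fin by (intro sum.mono_neutral_right) auto
  ultimately show ?thesis using \<open>F z \<noteq> 0\<close> by simp
qed

end

section \<open>Functionals as trace forms, the span of the points, and rotations\<close>

context hermitian_points
begin

text \<open>The element of \<open>F6\<close> whose trace form is the nonconstant part of the
  functional \<open>a\<close> on the points.\<close>

definition cf :: "'a ^ 7 \<Rightarrow> 'a alg_closure" where
  "cf a = (\<Sum>i\<in>UNIV-{0}. to_ac (a $ i) * \<theta> ^ e i)"

lemma to_ac_dotp_pt:
  assumes "x \<in> mu"
  shows "to_ac (dotp a (pt x)) = to_ac (a $ 0) + tr (cf a * x)"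
proof -
  have "to_ac (dotp a (pt x)) = to_ac (a $ 0) + (\<Sum>i\<in>UNIV-{0}. to_ac (a $ i * pt x $ i))"
    unfolding dotp_def by (subst sum.remove[of _ 0]) (simp_all add: to_ac_sum)
  also have "(\<Sum>i\<in>UNIV-{0}. to_ac (a $ i * pt x $ i)) = (\<Sum>i\<in>UNIV-{0}. tr (to_ac (a $ i) * (\<theta> ^ e i * x)))"
    using assms by (intro sum.cong refl) (simp add: to_ac_pt tr_to_ac_mult)
  also have "\<dots> = tr (cf a * x)"
    unfolding cf_def sum_distrib_right tr_sum by (simp only: mult.assoc)
  finally show ?thesis .
qed

text \<open>A polynomial over F_q of degree at most 5 that vanishes at \<theta> vanishes at all six
  conjugates, hence is zero.\<close>

lemma cf_eq_0_imp:
  fixes a :: "'a ^ 7"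
  assumes "cf a = 0" "i \<noteq> 0"
  shows "a $ i = 0"
proof -
  define p where "p = (\<Sum>i\<in>UNIV-{0}. monom (to_ac (a $ i)) (e i))"
  have e_less: "e i < 6" if "i \<noteq> 0" for i
    using bij_betw_apply[OF bij_e, of i] that by simp
  have "degree p \<le> 5"
    unfolding p_def
  proof (intro degree_sum_le)
    fix i :: 7 assume "i \<in> UNIV - {0}"
    then show "degree (monom (to_ac (a $ i)) (e i)) \<le> 5"
      using degree_monom_le[of "to_ac (a $ i)" "e i"] e_less[of i] by simp
  qed simp
  have "poly p ((frob ^^ k) \<theta>) = (frob ^^ k) (cf a)" for k
    by (simp add: p_def cf_def poly_sum poly_monom funpow_frob_sum funpow_frob_mult
        funpow_frob_power funpow_frob_to_ac)
  then have roots: "poly p z = 0" if "z \<in> (\<lambda>k. (frob ^^ k) \<theta>) ` {..<6}" for z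
    using that assms(1) by (auto simp: funpow_frob_0)
  have "p = 0"
    using roots \<open>degree p \<le> 5\<close> card_image[OF inj_on_conjugates[OF theta_mu theta_cube]]
    by (intro poly_eqI_degree[of "(\<lambda>k. (frob ^^ k) \<theta>) ` {..<6}"]) auto
  have "coeff p (e i) = (\<Sum>k\<in>UNIV-{0}. if k = i then to_ac (a $ k) else 0)"
    unfolding p_def coeff_sum using bij_betw_imp_inj_on[OF bij_e] assms(2)
    by (intro sum.cong refl) (auto simp: inj_on_eq_iff)
  also have "\<dots> = to_ac (a $ i)" using assms(2) by simp
  finally show ?thesis using \<open>p = 0\<close> by simp
qed

lemma cf_scale_diff: "cf (a - r *s b) = cf a - to_ac r * cf b"
  by (simp add: cf_def algebra_simps sum_subtractf sum_distrib_left)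

text \<open>Such a functional is a multiple of coordinate 0: its hyperplane is the one at infinity,
  which misses every point.\<close>

lemma dotp_pt_nonzero_if_cf_0:
  assumes "cf a = 0" "a \<noteq> 0" "x \<in> mu"
  shows "dotp a (pt x) \<noteq> 0"
proof
  assume "dotp a (pt x) = 0"
  then have "a $ 0 = 0" using to_ac_dotp_pt[OF assms(3), of a] assms(1) by simp
  then have "a $ i = 0" for i using cf_eq_0_imp[OF assms(1)] by (cases "i = 0") auto
  then show False using assms(2) by (simp add: vec_eq_iff)
qed

text \<open>If the two trace coefficients are dependent over F_q, the pencil contains the hyperplane
  at infinity and there is no common zero. Otherwise the resultant bound applies.\<close>

lemma card_common_zeros_pt:
  assumes ind: "\<And>s t. s *s a + t *s b = 0 \<Longrightarrow> s = 0 \<and> t = 0"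
  shows "card {x\<in>mu. dotp a (pt x) = 0 \<and> dotp b (pt x) = 0} \<le> 6"
proof (cases "cf a * frob (cf b) = cf b * frob (cf a)")
  case False
  have "{x\<in>mu. dotp a (pt x) = 0 \<and> dotp b (pt x) = 0}
      = {x\<in>mu. to_ac (a $ 0) + tr (cf a * x) = 0 \<and> to_ac (b $ 0) + tr (cf b * x) = 0}"
    by (auto simp flip: to_ac_dotp_pt)
  then show ?thesis using card_common_zeros_le_6[OF False] by simp
next
  case True
  have "\<exists>s t. (s \<noteq> 0 \<or> t \<noteq> 0) \<and> cf (s *s a - t *s b) = 0"
  proof (cases "cf b = 0")
    case True
    have "cf (0 *s a - 1 *s b) = 0 - to_ac 1 * cf b"
      using cf_scale_diff[of 0 1 b] by (simp add: cf_def)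
    then show ?thesis using True by (intro exI[of _ 0] exI[of _ 1]) simp
  next
    case False
    then have "frob (cf a / cf b) = cf a / cf b" using True by (simp add: frac_eq_eq mult.commute)
    then obtain r where "cf a / cf b = to_ac r" using frob_fixed_imp_range by blast
    then have "cf (1 *s a - r *s b) = 0" using False by (simp add: cf_scale_diff field_simps)
    then show ?thesis by (intro exI[of _ 1] exI[of _ r]) simp
  qed
  then obtain s t where st: "s \<noteq> 0 \<or> t \<noteq> 0" "cf (s *s a - t *s b) = 0" by blast
  have "s *s a - t *s b = s *s a + (- t) *s b" by simp
  then have "s *s a - t *s b \<noteq> 0" using st(1) ind[of s "- t"] by auto
  then have "{x\<in>mu. dotp a (pt x) = 0 \<and> dotp b (pt x) = 0} = {}"
    using dotp_pt_nonzero_if_cf_0[OF st(2)] by (fastforce simp: dotp_diff_left dotp_scale_left)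
  then show ?thesis by (simp only: card.empty)
qed

lemma frob_theta_neq: "frob \<theta> \<noteq> \<theta>"
  using inj_onD[OF inj_on_conjugates[OF theta_mu theta_cube], of 1 0] by auto

text \<open>A functional vanishing on all points also vanishes after rotation by \<^term>\<open>\<theta>\<close>; the two
  functionals would have more than six common zeros.\<close>
lemma span_pt: "vec.span (pt ` mu) = UNIV"
proof (rule ccontr)
  assume "vec.span (pt ` mu) \<noteq> UNIV"
  then obtain y where "y \<notin> vec.span (pt ` mu)" by blast
  then obtain a where a: "\<And>w. w \<in> vec.span (pt ` mu) \<Longrightarrow> dotp a w = 0" "dotp a y = 1"
    using exists_annihilating_functional[OF vec.subspace_span] by blast
  have zero: "to_ac (a $ 0) + tr (cf a * x) = 0" if "x \<in> mu" for x
    using to_ac_dotp_pt[OF that, of a] a(1)[of "pt x"] that by (simp add: vec.span_base)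
  have "a \<noteq> 0" using a(2) by (auto simp: dotp_0_left)
  then have "cf a \<noteq> 0"
    using dotp_pt_nonzero_if_cf_0[of a 1] a(1)[of "pt 1"] by (auto simp: vec.span_base)
  then have "cf a * frob (cf a * \<theta>) \<noteq> (cf a * \<theta>) * frob (cf a)"
    using frob_theta_neq by simp
  from card_common_zeros_le_6[OF this, of "to_ac (a $ 0)" "to_ac (a $ 0)"]
  have "card {x\<in>mu. to_ac (a $ 0) + tr (cf a * x) = 0 \<and> to_ac (a $ 0) + tr (cf a * \<theta> * x) = 0} \<le> 6" .
  moreover have "{x\<in>mu. to_ac (a $ 0) + tr (cf a * x) = 0 \<and> to_ac (a $ 0) + tr (cf a * \<theta> * x) = 0} = mu"
    using zero zero[OF mu_mult[OF theta_mu]] by (auto simp: mult.assoc)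
  ultimately show False using card_mu_ge[OF card_ge] by simp
qed

text \<open>Multiplication by \<open>t\<close> preserves the relations of
  \<open>pt_relation_iff\<close>, so its linear extension from a basis of points is right at all
  points. It is onto because its range contains the spanning points.\<close>

lemma exists_rotation:
  assumes "t \<in> mu"
  obtains A :: "'a ^ 7 ^ 7" where "invertible A" "\<And>x. x \<in> mu \<Longrightarrow> A *v pt x = pt (t * x)"
    and "\<And>w. (A *v w) $ 0 = w $ 0"
proof -
  obtain B where B: "B \<subseteq> pt ` mu" "vec.independent B" "pt ` mu \<subseteq> vec.span B"
    using vec.maximal_independent_subset[of "pt ` mu"] by metis
  obtain S where S: "S \<subseteq> mu" "B = pt ` S" using B(1) subset_imageE by metis
  have finS: "finite S" using S(1) finite_mu finite_subset by blast
  have injS: "inj_on pt S" using inj_on_pt S(1) inj_on_subset by blast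
  obtain g :: "'a ^ 7 \<Rightarrow> 'a ^ 7" where lin: "Vector_Spaces.linear (*s) (*s) g"
    and g: "\<forall>y\<in>B. g y = pt (t * inv_into mu pt y)"
    using vec.linear_independent_extend[OF B(2), of "\<lambda>y. pt (t * inv_into mu pt y)"] by blast
  have gS: "g (pt x) = pt (t * x)" if "x \<in> S" for x
    using g S that inj_on_pt by (auto simp: inv_into_f_f)
  interpret g: Vector_Spaces.linear "(*s)" "(*s)" g by (rule lin)
  have gmu: "g (pt x) = pt (t * x)" if x: "x \<in> mu" for x
  proof -
    have "pt x \<in> vec.span (pt ` S)" using x B(3) S(2) by auto
    then obtain u where u: "pt x = (\<Sum>v\<in>pt ` S. u v *s v)"
      using finS by (auto simp: vec.span_finite)
    define l where "l = u \<circ> pt"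
    have l: "pt x = (\<Sum>y\<in>S. l y *s pt y)"
      unfolding u by (simp add: sum.reindex[OF injS] l_def)
    \<comment> \<open>The extra index \<open>None\<close> carries \<open>x\<close> with coefficient
      -1, kept apart even when \<open>x\<close> already belongs to \<open>S\<close>.\<close>
    define I where "I = insert None (Some ` S)"
    define h where "h i = (case i of None \<Rightarrow> x | Some y \<Rightarrow> y)" for i
    define m where "m i = (case i of None \<Rightarrow> -1 | Some y \<Rightarrow> l y)" for i
    have sumI: "(\<Sum>i\<in>I. f i) = f None + (\<Sum>y\<in>S. f (Some y))" for f :: "'a alg_closure option \<Rightarrow> 'c::comm_monoid_add"
      using finS by (simp add: I_def sum.reindex)
    have "(\<Sum>i\<in>I. m i *s pt (h i)) = 0" by (simp add: sumI m_def h_def flip: l)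
    moreover have "h i \<in> mu" if "i \<in> I" for i using that x S(1) by (auto simp: I_def h_def)
    ultimately have rel: "(\<Sum>i\<in>I. m i) = 0" "(\<Sum>i\<in>I. to_ac (m i) * h i) = 0"
      using pt_relation_iff[of I h m] by auto
    have "(\<Sum>i\<in>I. to_ac (m i) * (t * h i)) = t * (\<Sum>i\<in>I. to_ac (m i) * h i)"
      unfolding sum_distrib_left by (rule sum.cong) (simp_all only: mult.left_commute)
    then have "(\<Sum>i\<in>I. to_ac (m i) * (t * h i)) = 0" using rel(2) by simp
    then have "(\<Sum>i\<in>I. m i *s pt (t * h i)) = 0"
      using pt_relation_iff[of I "\<lambda>i. t * h i" m] rel(1) \<open>\<And>i. i \<in> I \<Longrightarrow> h i \<in> mu\<close> assms mu_mult by auto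
    then have "pt (t * x) = (\<Sum>y\<in>S. l y *s pt (t * y))" by (simp add: sumI m_def h_def add_eq_0_iff)
    also have "\<dots> = g (pt x)" unfolding l g.sum g.scale using gS by simp
    finally show ?thesis by simp
  qed
  have "pt ` mu \<subseteq> range g"
  proof clarify
    fix x :: "'a alg_closure" assume "x \<in> mu"
    then have "inverse t * x \<in> mu" using assms by (intro mu_mult mu_inverse)
    then have "pt x = g (pt (inverse t * x))"
      using gmu[of "inverse t * x"] mu_nonzero[OF assms] by (simp flip: mult.assoc)
    then show "pt x \<in> range g" by blast
  qed
  moreover have "vec.subspace (range g)"
    using g.subspace_image[OF vec.subspace_UNIV] .
  ultimately have "surj g"
    using vec.span_minimal[of "pt ` mu" "range g"] span_pt by auto
  then have "inj g" using vec.linear_surjective_imp_injective[OF lin] by simp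
  define A where "A = matrix g"
  have A: "A *v w = g w" for w unfolding A_def by (rule matrix_works[OF lin])
  have "vec.subspace {w. g w $ 0 = w $ 0}"
    by (intro vec.subspaceI) (simp_all add: g.zero g.add g.scale)
  then have "vec.span (pt ` mu) \<subseteq> {w. g w $ 0 = w $ 0}"
    by (rule vec.span_minimal[rotated]) (auto simp: gmu)
  then have "(A *v w) $ 0 = w $ 0" for w using span_pt by (auto simp: A)
  moreover have "invertible A"
    using \<open>inj g\<close> matrix_left_invertible_injective[of A] invertible_left_inverse[of A]
    by (simp add: A inj_def)
  ultimately show thesis using that gmu A by metis
qed

end

section \<open>Six dependent points\<close>

lemma inverse_neq_self_mu:
  assumes "x \<in> mu" "x \<noteq> 1"
  shows "inverse x \<noteq> x"
proof
  assume "inverse x = x"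
  then have "x\<^sup>2 = 1" using mu_nonzero[OF assms(1)] by (metis power2_eq_square right_inverse)
  then have "x = -1" using assms(2) by (simp add: power2_eq_1_iff)
  \<comment> \<open>As \<open>frob\<close> fixes -1, the rule for \<open>frob (frob x)\<close> would
    give -1 = 1.\<close>
  then show False using frob_frob_mu[OF assms(1)] assms by simp
qed

lemma card_le_twice_card_image:
  assumes "finite A" "\<And>y. card {x\<in>A. f x = y} \<le> 2"
  shows "card A \<le> 2 * card (f ` A)"
proof -
  have "A = (\<Union>y\<in>f ` A. {x\<in>A. f x = y})" by auto
  then have "card A \<le> (\<Sum>y\<in>f ` A. card {x\<in>A. f x = y})"
    using card_UN_le[of "f ` A" "\<lambda>y. {x\<in>A. f x = y}"] assms(1) by simp
  also have "\<dots> \<le> of_nat (card (f ` A)) * 2" using assms(2) by (intro sum_bounded_above) simp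
  finally show ?thesis by simp
qed

text \<open>Differences x - 1/x with \<open>x\<close> in \<open>mu\<close> lie in this set, and so
  do their F_q-combinations.\<close>

lemma card_frob_cube_neg_le:
  "finite {z :: 'a::{finite,field} alg_closure. frob (frob (frob z)) = - z}"
  "card {z :: 'a alg_closure. frob (frob (frob z)) = - z} \<le> CARD('a) ^ 3"
proof -
  define P :: "'a alg_closure poly" where "P = monom 1 (CARD('a) ^ 3) + [:0, 1:]"
  have "CARD('a) > 1" using card_mono[OF finite, of "{0,1::'a}" UNIV] by (simp add: card_insert_if)
  then have gt: "CARD('a) ^ 3 > 1" by (metis one_less_power zero_less_numeral)
  then have deg: "degree P = CARD('a) ^ 3"
    unfolding P_def by (subst degree_add_eq_left) (auto simp: degree_monom_eq)
  then have "P \<noteq> 0" using gt by auto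
  have "{z. frob (frob (frob z)) = - z} = {z. poly P z = 0}"
    by (simp add: P_def poly_monom frob_def add_eq_0_iff2 power3_eq_cube flip: power_mult)
  then show "finite {z :: 'a alg_closure. frob (frob (frob z)) = - z}"
    "card {z :: 'a alg_closure. frob (frob (frob z)) = - z} \<le> CARD('a) ^ 3"
    using poly_roots_finite[OF \<open>P \<noteq> 0\<close>] card_poly_roots_bound[OF \<open>P \<noteq> 0\<close>] deg by simp_all
qed

context hermitian_points
begin

lemma theta_neq_1: "\<theta> \<noteq> 1"
  using theta_cube by auto

text \<open>The coefficients on each inverse pair are opposite, so their sum is zero and
  independence of at most five points applies.\<close>

lemma inverse_pair_relation_trivial:
  assumes x: "x \<in> mu" "x \<noteq> 1" "x \<noteq> \<theta>" "x \<noteq> inverse \<theta>"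
    and rel: "to_ac a * (\<theta> - inverse \<theta>) + to_ac b * (x - inverse x) = 0"
  shows "a = 0 \<and> b = 0"
proof -
  define l where "l y = (if y = \<theta> then a else if y = inverse \<theta> then - a else if y = x then b else - b)" for y
  have dist: "\<theta> \<noteq> inverse \<theta>" "x \<noteq> inverse x" "inverse x \<noteq> \<theta>" "inverse x \<noteq> inverse \<theta>"
    using inverse_neq_self_mu[OF theta_mu theta_neq_1] inverse_neq_self_mu[OF x(1,2)] x by auto
  note dist = dist dist[symmetric] x(3,4) x(3,4)[symmetric]
  let ?S = "{\<theta>, inverse \<theta>, x, inverse x}"
  have "(\<Sum>y\<in>?S. l y) = 0" using dist by (simp add: l_def)
  moreover have "(\<Sum>y\<in>?S. to_ac (l y) * y) = 0"
    using dist rel by (simp add: l_def algebra_simps)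
  moreover have "card ?S \<le> 5" using dist by simp
  moreover have "?S \<subseteq> mu" using theta_mu x mu_inverse by auto
  ultimately have "l \<theta> = 0" "l x = 0"
    using relation_le_5_trivial[of ?S l] by auto
  then show ?thesis using dist by (simp add: l_def)
qed

text \<open>There are q (q - 1) (q^2 - q - 2) > 2 q^3 triples for at most q^3 values, so three
  triples share one. Two of them differ by more than the symmetry (l, x) -> (-l, 1/x), and
  subtracting them relates three inverse pairs.\<close>

lemma six_dependent_if_card_ge_5:
  assumes q: "CARD('a) \<ge> 5"
  shows "\<exists>S l. S \<subseteq> mu \<and> card S = 6 \<and> (\<Sum>x\<in>S. l x) = (0::'a) \<and>
    (\<Sum>x\<in>S. to_ac (l x) * x) = 0 \<and> (\<exists>z\<in>S. l z \<noteq> 0)"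
proof -
  let ?M = "mu - {1, \<theta>, inverse \<theta>}"
  define A where "A = (UNIV::'a set) \<times> (UNIV - {0::'a}) \<times> ?M"
  define \<phi> where "\<phi> = (\<lambda>(l0, l, x). to_ac l0 * (\<theta> - inverse \<theta>) + to_ac l * (x - inverse x))"
  have dist: "\<theta> \<noteq> inverse \<theta>" "inverse \<theta> \<noteq> 1" "\<theta> \<noteq> 1"
    using inverse_neq_self_mu[OF theta_mu theta_neq_1] theta_neq_1 by auto
  have "card ?M = card (mu :: 'a alg_closure set) - 3"
    using dist theta_mu mu_inverse[OF theta_mu] by (subst card_Diff_subset) auto
  then have cardA: "card A = CARD('a) * ((CARD('a) - 1) * (card (mu :: 'a alg_closure set) - 3))"
    by (simp add: A_def card_cartesian_product card_Diff_singleton_if)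
  obtain k where k: "CARD('a) = k + 5" using q by (metis add.commute le_Suc_ex)
  have "card A > 2 * CARD('a) ^ 3"
    unfolding cardA card_mu k by (simp add: power2_eq_square power3_eq_cube algebra_simps)
  moreover have "\<phi> ` A \<subseteq> {z. frob (frob (frob z)) = - z}"
    using theta_mu by (auto simp: A_def \<phi>_def frob_frob_mu mu_nonzero divide_inverse algebra_simps)
  then have "card (\<phi> ` A) \<le> CARD('a) ^ 3"
    by (rule order.trans[OF card_mono[OF card_frob_cube_neg_le(1)] card_frob_cube_neg_le(2)])
  ultimately have "\<not> card A \<le> 2 * card (\<phi> ` A)" by linarith
  moreover have "finite A" by (simp add: A_def)
  ultimately obtain y where y: "card {p\<in>A. \<phi> p = y} > 2"
    using card_le_twice_card_image[of A \<phi>] by (meson not_le)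
  then have "{p\<in>A. \<phi> p = y} \<noteq> {}" by (metis card.empty not_less_zero)
  then obtain l0 l x where p: "(l0, l, x) \<in> A" "\<phi> (l0, l, x) = y" by auto
  have "\<not> {p\<in>A. \<phi> p = y} \<subseteq> {(l0, l, x), (l0, - l, inverse x)}"
    using y card_mono[of "{(l0, l, x), (l0, - l, inverse x)}" "{p\<in>A. \<phi> p = y}"]
    by (auto simp: card_insert_if split: if_splits)
  then obtain m0 m x' where p': "(m0, m, x') \<in> A" "\<phi> (m0, m, x') = y"
    "(m0, m, x') \<noteq> (l0, l, x)" "(m0, m, x') \<noteq> (l0, - l, inverse x)" by auto
  have x: "x \<in> mu" "x \<noteq> 1" "x \<noteq> \<theta>" "x \<noteq> inverse \<theta>" and x': "x' \<in> mu" "x' \<noteq> 1" "x' \<noteq> \<theta>" "x' \<noteq> inverse \<theta>"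
    and "l \<noteq> 0" using p(1) p'(1) by (auto simp: A_def)
  have eq: "to_ac l0 * (\<theta> - inverse \<theta>) + to_ac l * (x - inverse x)
      = to_ac m0 * (\<theta> - inverse \<theta>) + to_ac m * (x' - inverse x')"
    using p(2) p'(2) by (simp add: \<phi>_def)
  have "x' \<noteq> x"
  proof
    assume "x' = x"
    then have "to_ac (l0 - m0) * (\<theta> - inverse \<theta>) + to_ac (l - m) * (x - inverse x) = 0"
      using eq by (simp add: algebra_simps)
    from inverse_pair_relation_trivial[OF x this] show False using \<open>x' = x\<close> p'(3) by auto
  qed
  moreover have "x' \<noteq> inverse x"
  proof
    assume "x' = inverse x"
    then have "to_ac (l0 - m0) * (\<theta> - inverse \<theta>) + to_ac (l + m) * (x - inverse x) = 0"
      using eq by (simp add: algebra_simps)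
    from inverse_pair_relation_trivial[OF x this] show False
      using \<open>x' = inverse x\<close> p'(4) by (auto simp: add_eq_0_iff)
  qed
  moreover have "inverse x' \<noteq> inverse x" "inverse x' \<noteq> x" "x \<noteq> inverse x" "x' \<noteq> inverse x'"
    "inverse x \<noteq> \<theta>" "inverse x' \<noteq> \<theta>" "inverse x \<noteq> inverse \<theta>" "inverse x' \<noteq> inverse \<theta>"
    using calculation inverse_neq_self_mu[OF x(1,2)] inverse_neq_self_mu[OF x'(1,2)] x x' by auto
  ultimately have d: "x' \<noteq> x" "x' \<noteq> inverse x" "inverse x' \<noteq> inverse x" "inverse x' \<noteq> x"
    "x \<noteq> inverse x" "x' \<noteq> inverse x'" "inverse x \<noteq> \<theta>" "inverse x' \<noteq> \<theta>"
    "inverse x \<noteq> inverse \<theta>" "inverse x' \<noteq> inverse \<theta>" by blast+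
  note d = d d[symmetric] x(3,4) x'(3,4) x(3,4)[symmetric] x'(3,4)[symmetric] dist(1) dist(1)[symmetric]
  define S where "S = {\<theta>, inverse \<theta>, x, inverse x, x', inverse x'}"
  define c where "c y = (if y = \<theta> then l0 - m0 else if y = inverse \<theta> then m0 - l0
    else if y = x then l else if y = inverse x then - l else if y = x' then - m else m)" for y
  have "S \<subseteq> mu" using theta_mu x x' mu_inverse by (auto simp: S_def)
  moreover have "card S = 6" unfolding S_def using d by simp
  moreover have "(\<Sum>y\<in>S. c y) = 0" unfolding S_def using d by (simp add: c_def)
  moreover have "(\<Sum>y\<in>S. to_ac (c y) * y) = 0"
    unfolding S_def using d eq by (simp add: c_def algebra_simps)
  moreover have "x \<in> S" "c x \<noteq> 0" using \<open>l \<noteq> 0\<close> d by (auto simp: S_def c_def)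
  ultimately show ?thesis by blast
qed

text \<open>For \<open>q = 4\<close> the counting argument just fails. Here \<^term>\<open>\<theta>\<close> is a primitive 13th root of
  unity, and the Gauss period \<open>s\<close> over the quadratic residues modulo 13 lies in \<open>\<F>\<^sub>4\<close>.\<close>
lemma six_dependent_if_card_eq_4:
  assumes q: "CARD('a) = 4"
  shows "\<exists>S l. S \<subseteq> mu \<and> card S = 6 \<and> (\<Sum>x\<in>S. l x) = (0::'a) \<and>
    (\<Sum>x\<in>S. to_ac (l x) * x) = 0 \<and> (\<exists>z\<in>S. l z \<noteq> 0)"
proof -
  have t13: "\<theta> ^ 13 = 1" using theta_mu q by (simp add: mu_def)
  have "(2 * 2 :: 'a) = 0" using of_nat_card_finite_field[where 'a = 'a] q by simp
  then have two: "(2 :: 'a) = 0" by (metis mult_eq_0_iff)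
  have dbl: "u + u = 0" for u :: 'a using two by (metis mult_2 mult_zero_left)
  have "(2 :: 'a alg_closure) = 0" using two by (metis to_ac_0 to_ac_numeral)
  then have DBL: "u + u = 0" for u :: "'a alg_closure" by (metis mult_2 mult_zero_left)
  then have DBL2: "u + (u + v) = v" for u v :: "'a alg_closure" by (simp flip: add.assoc)
  have red: "\<theta> ^ n = \<theta> ^ (n - 13)" if "n \<ge> 13" for n
    using that t13 power_add[of \<theta> 13 "n - 13"] by simp
  have reds: "\<theta> ^ 13 = 1" "\<theta> ^ 14 = \<theta>" "\<theta> ^ 15 = \<theta> ^ 2" "\<theta> ^ 16 = \<theta> ^ 3" "\<theta> ^ 17 = \<theta> ^ 4"
    "\<theta> ^ 18 = \<theta> ^ 5" "\<theta> ^ 20 = \<theta> ^ 7" "\<theta> ^ 24 = \<theta> ^ 11"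
    using red[of 14] red[of 15] red[of 16] red[of 17] red[of 18] red[of 20] red[of 24] t13 by simp_all
  define s where "s = \<theta> + \<theta> ^ 3 + \<theta> ^ 4 + \<theta> ^ 9 + \<theta> ^ 10 + \<theta> ^ 12"
  define n where "n = \<theta> ^ 2 + \<theta> ^ 5 + \<theta> ^ 6 + \<theta> ^ 7 + \<theta> ^ 8 + \<theta> ^ 11"
  have sq: "(u + v)\<^sup>2 = u\<^sup>2 + v\<^sup>2" for u v :: "'a alg_closure"
    using DBL[of "u * v"] by (simp add: power2_eq_square algebra_simps DBL2)
  \<comment> \<open>As 2 is a non-residue modulo 13, squaring in characteristic two exchanges the
    two periods.\<close>
  have s2: "s\<^sup>2 = n"
    by (simp add: s_def n_def sq reds add_ac flip: power_mult)
  have "(\<theta> - 1) * (\<Sum>i<13. \<theta> ^ i) = 0" using power_diff_1_eq[of \<theta> 13] t13 by simp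
  then have "(\<Sum>i<13. \<theta> ^ i) = 0" using theta_neq_1 by simp
  then have "1 + s + n = 0"
    by (simp add: s_def n_def eval_nat_numeral add_ac)
  then have n: "n = s + 1" by (metis DBL add.commute add_left_imp_eq)
  have "frob s = (s\<^sup>2)\<^sup>2" by (simp add: frob_def q flip: power_mult)
  also have "\<dots> = s"
    unfolding s2 n sq by (simp add: s2 n add_ac DBL DBL2)
  finally obtain r where r: "s = to_ac r" using frob_fixed_imp_range by blast
  \<comment> \<open>After reducing exponents modulo 13, each power of \<theta> occurs an even number
    of times.\<close>
  have rel: "1 + \<theta> + n * \<theta> ^ 2 + s * \<theta> ^ 4 + n * \<theta> ^ 5 + s * \<theta> ^ 8 = 0"
    by (simp only: n_def s_def distrib_right power_add[symmetric] power_Suc[symmetric])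
       (simp add: reds add_ac DBL DBL2)
  \<comment> \<open>Here \<open>k\<close> is an inverse of \<open>d\<close> modulo 13, so raising to
    the power \<open>k\<close> recovers \<theta>.\<close>
  have order_13: "\<theta> ^ d \<noteq> 1" if "d * k = Suc (13 * m)" for d k m
  proof
    assume "\<theta> ^ d = 1"
    then have "\<theta> ^ (d * k) = 1" by (simp add: power_mult)
    moreover have "\<theta> ^ (d * k) = \<theta>" unfolding that by (simp add: power_mult t13)
    ultimately show False using theta_neq_1 by simp
  qed
  have small: "\<theta> ^ d \<noteq> 1" if "0 < d" "d \<le> 8" for d
  proof -
    have "d \<in> {1,2,3,4,5,6,7,8}" using that by auto
    then show ?thesis
      using order_13[of 1 1 0] order_13[of 2 7 1] order_13[of 3 9 2] order_13[of 4 10 3]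
        order_13[of 5 8 3] order_13[of 6 11 5] order_13[of 7 2 1] order_13[of 8 5 3] by auto
  qed
  have less: "\<theta> ^ i \<noteq> \<theta> ^ j" if "i < j" "j \<le> 8" for i j
  proof -
    have "\<theta> ^ j = \<theta> ^ i * \<theta> ^ (j - i)"
      using that(1) by (simp flip: power_add)
    moreover have "\<theta> ^ i * \<theta> ^ (j - i) \<noteq> \<theta> ^ i * 1"
      unfolding mult_left_cancel[OF power_not_zero[OF mu_nonzero[OF theta_mu]]]
      using that by (intro small) simp_all
    ultimately show ?thesis by simp
  qed
  define p where "p i = \<theta> ^ i" for i :: nat
  have inj: "inj_on p {..8}"
    by (rule inj_onI) (metis less p_def atMost_iff linorder_neqE_nat)
  define I where "I = {0, 1, 2, 4, 5, 8::nat}"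
  have injI: "inj_on p I" using inj by (rule inj_on_subset) (auto simp: I_def)
  define c where "c i = (if i \<le> 1 then 1 else if i = 2 \<or> i = 5 then r + 1 else r)" for i :: nat
  define l where "l = c \<circ> inv_into I p"
  have l: "l (p i) = c i" if "i \<in> I" for i using that injI by (simp add: l_def)
  have "p ` I \<subseteq> mu" using mu_power[OF theta_mu] by (auto simp: p_def)
  moreover have "card (p ` I) = 6" by (simp add: card_image[OF injI]) (simp add: I_def)
  moreover have "(\<Sum>i\<in>I. c i) = 0"
    using dbl[of 1] dbl[of r] two by (simp add: I_def c_def algebra_simps)
  then have "(\<Sum>x\<in>p ` I. l x) = 0" by (simp add: sum.reindex[OF injI] l)
  moreover have "(\<Sum>i\<in>I. to_ac (c i) * p i) = 0"
    using rel by (simp add: I_def c_def p_def n add_ac flip: r)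
  then have "(\<Sum>x\<in>p ` I. to_ac (l x) * x) = 0"
    by (simp add: sum.reindex[OF injI] l)
  moreover have "p 0 \<in> p ` I" "l (p 0) \<noteq> 0" using l[of 0] by (auto simp: I_def c_def)
  ultimately show ?thesis by blast
qed

end

section \<open>Intersections of the points with subspaces\<close>

lemma proj_map_proj_point:
  fixes A :: "'a::field ^ 'n ^ 'n"
  shows "proj_map A (proj_point v) = proj_point (A *v v)"
proof -
  have "proj_point u = (\<lambda>c. c *s u) ` {c. c \<noteq> 0}" for u :: "'a ^ 'n"
    by (auto simp: proj_point_def)
  then show ?thesis
    by (simp add: proj_map_def image_image vector_scalar_commute)
qed

context hermitian_points
begin

lemma exists_six_pts_dim_le_5:
  obtains S where "S \<subseteq> mu" "card S = 6" "vec.dim (pt ` S) \<le> 5"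
proof -
  have "CARD('a) \<ge> 5 \<or> CARD('a) = 4" using card_ge by linarith
  then obtain S l z where S: "S \<subseteq> mu" "card S = 6" "(\<Sum>x\<in>S. l x) = (0::'a)"
    "(\<Sum>x\<in>S. to_ac (l x) * x) = 0" and z: "z \<in> S" "l z \<noteq> 0"
    using six_dependent_if_card_ge_5 six_dependent_if_card_eq_4 by blast
  have fin: "finite S" using S(1) finite_mu by (rule finite_subset)
  have "(\<Sum>x\<in>S. l x *s pt x) = 0"
    using pt_relation_iff[of S "\<lambda>x. x" l] S by auto
  then have "l z *s pt z = - (\<Sum>x\<in>S - {z}. l x *s pt x)"
    using fin z(1) by (simp add: sum.remove add_eq_0_iff2)
  also have "\<dots> \<in> vec.span (pt ` (S - {z}))"
    by (intro vec.span_neg vec.span_sum vec.span_scale vec.span_base) auto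
  finally have "inverse (l z) *s (l z *s pt z) \<in> vec.span (pt ` (S - {z}))"
    by (rule vec.span_scale)
  then have "pt z \<in> vec.span (pt ` (S - {z}))" using z(2) by simp
  then have "pt ` S \<subseteq> vec.span (pt ` (S - {z}))"
    by (auto intro: vec.span_base)
  then have "vec.dim (pt ` S) \<le> card (pt ` (S - {z}))"
    using fin by (intro vec.dim_le_card) auto
  also have "\<dots> \<le> card (S - {z})" using fin by (intro card_image_le) simp
  also have "\<dots> = 5" using S(2) z(1) fin by simp
  finally show thesis using that S by blast
qed

text \<open>Five points in a projective solid would be five independent vectors in dimension
  four.\<close>

lemma card_pt_in_dim_4:
  assumes "vec.subspace W" "vec.dim W = 4"
  shows "card {x\<in>mu. pt x \<in> W} \<le> 4"
proof (rule ccontr)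
  assume "\<not> card {x\<in>mu. pt x \<in> W} \<le> 4"
  then have "5 \<le> card {x\<in>mu. pt x \<in> W}" by simp
  then obtain T where T: "T \<subseteq> {x\<in>mu. pt x \<in> W}" "card T = 5" "finite T"
    by (rule obtain_subset_with_card_n)
  have inj: "inj_on pt T" using inj_on_pt T(1) by (auto intro: inj_on_subset)
  have "vec.independent (pt ` T)"
  proof (rule vec.independent_if_scalars_zero)
    fix u v assume 0: "(\<Sum>x\<in>pt ` T. u x *s x) = 0" and v: "v \<in> pt ` T"
    then obtain z where z: "z \<in> T" "v = pt z" by blast
    have "(\<Sum>x\<in>T. u (pt x) *s pt x) = 0" using 0 by (simp add: sum.reindex[OF inj])
    then have "(\<Sum>x\<in>T. u (pt x)) = 0 \<and> (\<Sum>x\<in>T. to_ac (u (pt x)) * x) = 0"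
      using pt_relation_iff[of T "\<lambda>x. x" "\<lambda>x. u (pt x)"] T(1) by auto
    then show "u v = 0"
      using relation_le_5_trivial[of T "\<lambda>x. u (pt x)" z] T z by auto
  qed (use T in simp)
  moreover have "pt ` T \<subseteq> W" using T(1) by auto
  ultimately have "card (pt ` T) \<le> vec.dim W" by (rule vec.independent_card_le_dim[rotated])
  then show False using T(2) assms(2) by (simp add: card_image[OF inj])
qed

lemma card_pt_in_dim_5:
  assumes "vec.subspace W" "vec.dim W = 5"
  shows "card {x\<in>mu. pt x \<in> W} \<le> 6"
proof -
  obtain a b :: "'a ^ 7" where ab: "\<And>w. w \<in> W \<Longrightarrow> dotp a w = 0" "\<And>w. w \<in> W \<Longrightarrow> dotp b w = 0"
    and ind: "\<And>s t. s *s a + t *s b = 0 \<Longrightarrow> s = 0 \<and> t = 0"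
    using exists_two_annihilating_functionals[OF assms(1)] assms(2) by auto
  have "card {x\<in>mu. pt x \<in> W} \<le> card {x\<in>mu. dotp a (pt x) = 0 \<and> dotp b (pt x) = 0}"
    using ab by (intro card_mono) auto
  also have "\<dots> \<le> 6" using ind by (rule card_common_zeros_pt)
  finally show ?thesis .
qed

lemma exists_dim_5_card_pt_ge_6:
  obtains W where "vec.subspace W" "vec.dim W = 5" "card {x\<in>mu. pt x \<in> W} \<ge> 6"
proof -
  obtain S where S: "S \<subseteq> mu" "card S = 6" "vec.dim (pt ` S) \<le> 5"
    by (rule exists_six_pts_dim_le_5)
  obtain W where W: "vec.subspace W" "pt ` S \<subseteq> W" "vec.dim W = 5"
    using exists_superspace_dim[OF S(3)] by auto
  have "card S \<le> card {x\<in>mu. pt x \<in> W}" using S(1) W(2) by (intro card_mono) auto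
  then show thesis using that W S(2) by simp
qed

text \<open>The \<open>q + 1\<close> hyperplanes through a 4-space with six points partition the remaining
  \<open>q\<^sup>2 - q - 5 > q + 1\<close> points.\<close>
lemma exists_dim_6_card_pt_ge_8:
  obtains W where "vec.subspace W" "vec.dim W = 6" "card {x\<in>mu. pt x \<in> W} \<ge> 8"
proof -
  obtain W where W: "vec.subspace W" "vec.dim W = 5" "card {x\<in>mu. pt x \<in> W} \<ge> 6"
    by (rule exists_dim_5_card_pt_ge_6)
  obtain a b :: "'a ^ 7" where ab: "\<And>w. w \<in> W \<Longrightarrow> dotp a w = 0" "\<And>w. w \<in> W \<Longrightarrow> dotp b w = 0"
    and ind: "\<And>s t. s *s a + t *s b = 0 \<Longrightarrow> s = 0 \<and> t = 0"
    using exists_two_annihilating_functionals[OF W(1)] W(2) by auto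
  define Z where "Z = {x\<in>mu. dotp a (pt x) = 0 \<and> dotp b (pt x) = 0}"
  have "card {x\<in>mu. pt x \<in> W} \<le> card Z"
    unfolding Z_def using ab by (intro card_mono) auto
  moreover have "card Z \<le> 6" unfolding Z_def using ind by (rule card_common_zeros_pt)
  ultimately have Z: "card Z = 6" using W(3) by simp
  have ZM: "Z \<subseteq> mu" by (auto simp: Z_def)
  \<comment> \<open>The parameter of the hyperplane of the pencil through the point of
    \<open>x\<close>; \<open>None\<close> stands for the hyperplane of \<open>b\<close>.\<close>
  define f where "f x = (if dotp b (pt x) = 0 then None else Some (dotp a (pt x) / dotp b (pt x)))" for x
  obtain k where k: "CARD('a) = k + 4" using card_ge by (metis add.commute le_Suc_ex)
  have "card (mu - Z) = card (mu :: 'a alg_closure set) - 6"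
    using ZM Z by (simp add: card_Diff_subset finite_subset[OF ZM])
  moreover have "CARD('a option) < card (mu :: 'a alg_closure set) - 6"
    unfolding card_mu card_UNIV_option k by (simp add: power2_eq_square algebra_simps)
  moreover have "card (f ` (mu - Z)) \<le> CARD('a option)" by (intro card_mono) auto
  ultimately have "card (f ` (mu - Z)) \<noteq> card (mu - Z)" by linarith
  then have "\<not> inj_on f (mu - Z)" using card_image by blast
  then obtain x y where xy: "x \<in> mu - Z" "y \<in> mu - Z" "x \<noteq> y" "f x = f y"
    by (auto simp: inj_on_def)
  define c where "c = dotp b (pt x) *s a - dotp a (pt x) *s b"
  have "c \<noteq> 0" using ind[of "dotp b (pt x)" "- dotp a (pt x)"] xy(1) by (auto simp: c_def Z_def)
  have "dotp c (pt x) = 0" by (simp add: c_def dotp_diff_left dotp_scale_left)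
  moreover have "dotp c (pt y) = 0"
    using xy(4) by (auto simp: c_def dotp_diff_left dotp_scale_left f_def field_simps split: if_splits)
  moreover have "dotp c (pt z) = 0" if "z \<in> Z" for z
    using that by (simp add: c_def Z_def dotp_diff_left dotp_scale_left)
  ultimately have sub: "insert x (insert y Z) \<subseteq> {z\<in>mu. dotp c (pt z) = 0}"
    using xy ZM by auto
  have "card (insert x (insert y Z)) = 8"
    using xy Z finite_subset[OF ZM] by simp
  then have 8: "8 \<le> card {z\<in>mu. dotp c (pt z) = 0}"
    using card_mono[OF _ sub] by simp
  obtain i where "c $ i \<noteq> 0" using \<open>c \<noteq> 0\<close> by (auto simp: vec_eq_iff)
  then have "dotp c (axis i 1) \<noteq> 0"
    by (simp add: dotp_def axis_def if_distrib cong: if_cong)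
  then have "{w. dotp c w = 0} \<noteq> UNIV" by blast
  then have "\<not> vec.dim (UNIV :: ('a ^ 7) set) \<le> vec.dim {w. dotp c w = 0}"
    using vec.subspace_dim_equal[OF subspace_dotp_eq_0 vec.subspace_UNIV subset_UNIV, of c] by blast
  moreover have "vec.dim (UNIV :: ('a ^ 7) set) = 7" by (subst vec_dim_card) simp
  ultimately have "vec.dim {w. dotp c w = 0} \<le> 6" by linarith
  then obtain H where H: "vec.subspace H" "{w. dotp c w = 0} \<subseteq> H" "vec.dim H = 6"
    using exists_superspace_dim[of "{w. dotp c w = 0}" 6] by auto
  have "card {z\<in>mu. dotp c (pt z) = 0} \<le> card {z\<in>mu. pt z \<in> H}"
    using H(2) by (intro card_mono) auto
  then show thesis using that H 8 by simp
qed

section \<open>The projective point set and its transitive group\<close>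

definition cap :: "('a ^ 7) set set" where
  "cap = (\<lambda>x. proj_point (pt x)) ` mu"

lemma pt_nonzero: "pt x \<noteq> 0"
  by (metis pt_0 zero_index zero_neq_one)

lemma inj_on_proj_point_pt: "inj_on (\<lambda>x. proj_point (pt x)) mu"
proof (rule inj_onI)
  fix x y assume xy: "x \<in> mu" "y \<in> mu" "proj_point (pt x) = proj_point (pt y)"
  have "1 *s pt x \<in> proj_point (pt x)" unfolding proj_point_def using one_neq_zero by blast
  then obtain c where c: "pt x = c *s pt y" using xy(3) by (auto simp: proj_point_def)
  then have "pt x $ 0 = (c *s pt y) $ 0" by (simp only:)
  then have "c = 1" by simp
  then show "x = y" using c xy inj_on_pt by (simp add: inj_on_eq_iff)
qed

lemma pts_in_cap:
  assumes "vec.subspace W"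
  shows "pts_in cap W = card {x\<in>mu. pt x \<in> W}"
proof -
  have "{P\<in>cap. P \<subseteq> W} = (\<lambda>x. proj_point (pt x)) ` {x\<in>mu. pt x \<in> W}"
    using proj_point_subset_iff[OF assms] by (auto simp: cap_def)
  moreover have "inj_on (\<lambda>x. proj_point (pt x)) {x\<in>mu. pt x \<in> W}"
    using inj_on_proj_point_pt by (auto intro: inj_on_subset)
  ultimately show ?thesis by (simp add: pts_in_def card_image)
qed

lemma is_proj_point_cap: "P \<in> cap \<Longrightarrow> is_proj_point P"
  using pt_nonzero by (auto simp: cap_def is_proj_point_def)

lemma span_Union_cap: "vec.span (\<Union>cap) = UNIV"
proof -
  have "pt x \<in> \<Union>cap" if "x \<in> mu" for x
  proof -
    have "1 *s pt x \<in> proj_point (pt x)" unfolding proj_point_def using one_neq_zero by blast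
    then show ?thesis using that by (auto simp: cap_def)
  qed
  then have "vec.span (pt ` mu) \<subseteq> vec.span (\<Union>cap)" by (intro vec.span_mono) auto
  then show ?thesis using span_pt by auto
qed

lemma k_general_cap: "k_general 5 cap"
proof -
  obtain W where "vec.subspace W" "vec.dim W = 5" "card {x\<in>mu. pt x \<in> W} \<ge> 6"
    by (rule exists_dim_5_card_pt_ge_6)
  then have "\<exists>W. proj_subspace (3 + 1) W \<and> pts_in cap W \<ge> 4 + 2"
    by (intro exI[of _ W]) (simp add: proj_subspace_def pts_in_cap)
  then show ?thesis
    using is_proj_point_cap span_Union_cap card_pt_in_dim_4
    by (auto simp: k_general_def rs_set_def proj_subspace_def pts_in_cap)
qed

lemma rs_set_cap: "rs_set 6 4 cap"
proof -
  obtain W where "vec.subspace W" "vec.dim W = 6" "card {x\<in>mu. pt x \<in> W} \<ge> 8"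
    by (rule exists_dim_6_card_pt_ge_8)
  then have "\<exists>W. proj_subspace (4 + 1) W \<and> pts_in cap W \<ge> 6 + 2"
    by (intro exI[of _ W]) (simp add: proj_subspace_def pts_in_cap)
  then show ?thesis
    using is_proj_point_cap span_Union_cap card_pt_in_dim_5
    by (auto simp: rs_set_def proj_subspace_def pts_in_cap)
qed

lemma affine_point_set_cap: "affine_point_set cap"
proof -
  have "pt x \<in> proj_point (pt x)" for x
    unfolding proj_point_def by (auto intro!: exI[of _ 1])
  then show ?thesis by (fastforce simp: affine_point_set_def cap_def H_inf_def)
qed

lemma transitive_cap:
  assumes "P \<in> cap" "Q \<in> cap"
  shows "\<exists>A :: 'a ^ 7 ^ 7. invertible A \<and> proj_map A ` cap = cap \<and> proj_map A H_inf = H_inf \<and>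
    proj_map A P = Q"
proof -
  obtain x y where xy: "x \<in> mu" "P = proj_point (pt x)" "y \<in> mu" "Q = proj_point (pt y)"
    using assms by (auto simp: cap_def)
  define t where "t = y * inverse x"
  have t: "t \<in> mu" using xy by (simp add: t_def mu_mult mu_inverse)
  obtain A :: "'a ^ 7 ^ 7" where A: "invertible A" "\<And>z. z \<in> mu \<Longrightarrow> A *v pt z = pt (t * z)"
    and A0: "\<And>w. (A *v w) $ 0 = w $ 0"
    using exists_rotation[OF t] by blast
  have A_cap: "proj_map A (proj_point (pt z)) = proj_point (pt (t * z))" if "z \<in> mu" for z
    using that by (simp add: proj_map_proj_point A(2))
  have "(\<lambda>z. t * z) ` mu = mu"
  proof
    show "(\<lambda>z. t * z) ` mu \<subseteq> mu" using t mu_mult by auto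
    show "mu \<subseteq> (\<lambda>z. t * z) ` mu"
    proof
      fix z :: "'a alg_closure" assume "z \<in> mu"
      then have "inverse t * z \<in> mu" "z = t * (inverse t * z)"
        using t mu_nonzero[OF t] by (simp_all add: mu_mult mu_inverse flip: mult.assoc)
      then show "z \<in> (\<lambda>z. t * z) ` mu" by blast
    qed
  qed
  have "proj_map A ` cap = (\<lambda>z. proj_point (pt (t * z))) ` mu"
    unfolding cap_def image_image using A_cap by (rule image_cong[OF refl])
  also have "\<dots> = (\<lambda>z. proj_point (pt z)) ` (\<lambda>z. t * z) ` mu" by (simp add: image_image)
  also have "\<dots> = cap" unfolding \<open>(\<lambda>z. t * z) ` mu = mu\<close> cap_def ..
  finally have "proj_map A ` cap = cap" .
  moreover have "proj_map A H_inf = H_inf"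
  proof -
    \<comment> \<open>The preimage of \<open>w\<close> under \<open>A\<close> has the same
      coordinate 0 as \<open>w\<close>, so \<open>A\<close> maps \<open>H_inf\<close> onto
      itself.\<close>
    obtain B where B: "A ** B = mat 1" using A(1) by (auto simp: invertible_def)
    have AB: "A *v (B *v w) = w" for w by (simp add: matrix_vector_mul_assoc B)
    have "w \<in> (*v) A ` H_inf" if "w \<in> H_inf" for w
      using that AB[of w] A0[of "B *v w"] by (intro image_eqI[of _ _ "B *v w"]) (auto simp: H_inf_def)
    then show ?thesis using A0 by (auto simp: proj_map_def H_inf_def)
  qed
  moreover have "proj_map A P = Q"
    using A_cap[OF xy(1)] xy mu_nonzero[OF xy(1)] by (simp add: t_def mult.assoc)
  ultimately show ?thesis using A(1) by blast
qed

end

section \<open>Choice of \<theta> and conclusion\<close>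

theorem mainTheorem13:
  assumes "CARD('a::{finite,field}) \<ge> 4"
  shows "\<exists>X :: ('a ^ 7) set set.
     affine_point_set X \<and>
     card X = CARD('a)^2 - CARD('a) + 1 \<and>
     k_general 5 X \<and> rs_set 6 4 X \<and>
     (\<forall>P\<in>X. \<forall>Q\<in>X. \<exists>A :: 'a ^ 7 ^ 7.
         invertible A \<and> proj_map A ` X = X \<and> proj_map A H_inf = H_inf \<and>
         proj_map A P = Q)"
proof -
  have "\<exists>\<theta> :: 'a alg_closure. \<theta> \<in> mu \<and> \<theta> ^ 3 \<noteq> 1"
  proof (rule ccontr)
    \<comment> \<open>Otherwise all elements of \<open>mu\<close>, at least 13 in number, would be
      roots of X^3 - 1.\<close>
    assume none: "\<nexists>\<theta> :: 'a alg_closure. \<theta> \<in> mu \<and> \<theta> ^ 3 \<noteq> 1"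
    define P :: "'a alg_closure poly" where "P = monom 1 3 + [:-1:]"
    have deg: "degree P = 3"
      unfolding P_def by (subst degree_add_eq_left) (auto simp: degree_monom_eq)
    then have "P \<noteq> 0" by auto
    have "mu \<subseteq> {z. poly P z = 0}"
      using none by (auto simp: P_def poly_monom)
    then have "card (mu :: 'a alg_closure set) \<le> 3"
      using card_mono[OF poly_roots_finite[OF \<open>P \<noteq> 0\<close>]] card_poly_roots_bound[OF \<open>P \<noteq> 0\<close>] deg
      by (metis order.trans)
    then show False using card_mu_ge[OF assms] by simp
  qed
  then obtain \<theta> :: "'a alg_closure" where \<theta>: "\<theta> \<in> mu" "\<theta> ^ 3 \<noteq> 1" by blast
  have "card (UNIV - {0 :: 7}) = card {..<6::nat}" by (simp add: card_Diff_singleton_if)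
  then obtain e where "bij_betw e (UNIV - {0 :: 7}) {..<6::nat}"
    using finite_same_card_bij[of "UNIV - {0 :: 7}" "{..<6::nat}"] by auto
  with \<theta> assms interpret hermitian_points \<theta> e by unfold_locales
  have "card cap = CARD('a)^2 - CARD('a) + 1"
    unfolding cap_def by (simp add: card_image[OF inj_on_proj_point_pt] card_mu)
  then show ?thesis
    using affine_point_set_cap k_general_cap rs_set_cap transitive_cap by (intro exI[of _ cap]) simp
qed

end
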